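(* Let $X$ be a connected CW complex which is an $H$-space. Then $\mathsf{TC}^{\mathcal D}(X)=\mathrm{cat}_1(X)$.
   Context: $\mathrm{secat}(p)$ is the least $n$ such that the base of $p$ has an open cover by $n+1$ sets each admitting a continuous local section of $p$. $\mathrm{cat}_1(Z)$ is $\mathrm{secat}$ of the universal covering $\tilde Z\to Z$. $\mathsf{TC}^{\mathcal D}(X)$ is the least $k$ such that $X\times X=U_0\cup\dots\cup U_k$ with $U_i$ open and such that for every $i$ and every basepoint $u\in U_i$ the homomorphism $\pi_1(U_i,u)\to\pi_1(X\times X,u)\cong\pi\times\pi$ ($\pi=\pi_1(X)$) induced by inclusion takes values in a subgroup conjugate to the diagonal $\Delta\subset\pi\times\pi$. *)

theory Defs
  imports "HOL-Analysis.Analysis" "HOL-Library.Extended_Nat"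
begin

definition disc_set :: "nat \<Rightarrow> (nat \<Rightarrow> real) set" where
  "disc_set n = {x. (\<forall>i\<ge>n. x i = 0) \<and> (\<Sum>i<n. (x i)^2) \<le> 1}"

definition open_disc_set :: "nat \<Rightarrow> (nat \<Rightarrow> real) set" where
  "open_disc_set n = {x. (\<forall>i\<ge>n. x i = 0) \<and> (\<Sum>i<n. (x i)^2) < 1}"

definition sphere_set :: "nat \<Rightarrow> (nat \<Rightarrow> real) set" where
  "sphere_set n = {x. (\<forall>i\<ge>n. x i = 0) \<and> (\<Sum>i<n. (x i)^2) = 1}"

definition disc :: "nat \<Rightarrow> (nat \<Rightarrow> real) topology" where
  "disc n = subtopology (Euclidean_space n) (disc_set n)"

definition cw_complex :: "'a topology \<Rightarrow> bool" where
  "cw_complex X \<longleftrightarrow> Hausdorff_space X \<and>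
    (\<exists>C :: (nat \<times> ((nat \<Rightarrow> real) \<Rightarrow> 'a)) set.
       (\<forall>(n,\<Phi>)\<in>C.
          continuous_map (disc n) X \<Phi> \<and>
          homeomorphic_map (subtopology (disc n) (open_disc_set n))
                           (subtopology X (\<Phi> ` open_disc_set n)) \<Phi> \<and>
          (\<exists>F. finite F \<and> F \<subseteq> C \<and> (\<forall>(m,\<Psi>)\<in>F. m < n) \<and>
               \<Phi> ` sphere_set n \<subseteq> (\<Union>(m,\<Psi>)\<in>F. \<Psi> ` open_disc_set m))) \<and>
       (\<forall>c\<in>C. \<forall>d\<in>C. c \<noteq> d \<longrightarrow>
          disjnt (snd c ` open_disc_set (fst c)) (snd d ` open_disc_set (fst d))) \<and>
       topspace X = (\<Union>(n,\<Phi>)\<in>C. \<Phi> ` open_disc_set n) \<and>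
       (\<forall>A\<subseteq>topspace X. closedin X A \<longleftrightarrow>
          (\<forall>(n,\<Phi>)\<in>C. closedin (disc n) {x \<in> topspace (disc n). \<Phi> x \<in> A})))"

definition h_space :: "'a topology \<Rightarrow> bool" where
  "h_space X \<longleftrightarrow> (\<exists>\<mu> e. e \<in> topspace X \<and> continuous_map (prod_topology X X) X \<mu> \<and>
      homotopic_with (\<lambda>_. True) X X (\<lambda>x. \<mu> (e, x)) id \<and>
      homotopic_with (\<lambda>_. True) X X (\<lambda>x. \<mu> (x, e)) id)"

definition pjoin :: "(real \<Rightarrow> 'a) \<Rightarrow> (real \<Rightarrow> 'a) \<Rightarrow> real \<Rightarrow> 'a" where
  "pjoin g h t = (if t \<le> 1/2 then g (2 * t) else h (2 * t - 1))"

definition prev :: "(real \<Rightarrow> 'a) \<Rightarrow> real \<Rightarrow> 'a" where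
  "prev g t = g (1 - t)"

definition path_homotopic :: "'a topology \<Rightarrow> (real \<Rightarrow> 'a) \<Rightarrow> (real \<Rightarrow> 'a) \<Rightarrow> bool" where
  "path_homotopic X p q \<longleftrightarrow> pathin X p \<and> pathin X q \<and> p 0 = q 0 \<and> p 1 = q 1 \<and>
     homotopic_with (\<lambda>r. r 0 = p 0 \<and> r 1 = p 1) (top_of_set {0..1}) X p q"

definition loop_at :: "'a topology \<Rightarrow> 'a \<Rightarrow> (real \<Rightarrow> 'a) \<Rightarrow> bool" where
  "loop_at X a l \<longleftrightarrow> pathin X l \<and> l 0 = a \<and> l 1 = a"

definition simply_connected_space :: "'a topology \<Rightarrow> bool" where
  "simply_connected_space E \<longleftrightarrow> path_connected_space E \<and>
     (\<forall>l a. loop_at E a l \<longrightarrow> path_homotopic E l (\<lambda>_. a))"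

definition covering_map :: "'b topology \<Rightarrow> 'a topology \<Rightarrow> ('b \<Rightarrow> 'a) \<Rightarrow> bool" where
  "covering_map E B p \<longleftrightarrow> continuous_map E B p \<and> p ` topspace E = topspace B \<and>
     (\<forall>x\<in>topspace B. \<exists>U. x \<in> U \<and> openin B U \<and>
        (\<exists>V. \<Union>V = {y \<in> topspace E. p y \<in> U} \<and> (\<forall>W\<in>V. openin E W) \<and>
             pairwise disjnt V \<and>
             (\<forall>W\<in>V. homeomorphic_map (subtopology E W) (subtopology B U) p)))"

definition universal_covering :: "'b topology \<Rightarrow> 'a topology \<Rightarrow> ('b \<Rightarrow> 'a) \<Rightarrow> bool" where
  "universal_covering E B p \<longleftrightarrow> covering_map E B p \<and> simply_connected_space E"

definition secat :: "('b \<Rightarrow> 'a) \<Rightarrow> 'b topology \<Rightarrow> 'a topology \<Rightarrow> enat" where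
  "secat p E B = Inf {enat n | n. \<exists>U :: nat \<Rightarrow> 'a set.
      (\<forall>i\<le>n. openin B (U i) \<and>
         (\<exists>s. continuous_map (subtopology B (U i)) E s \<and> (\<forall>x\<in>U i. p (s x) = x))) \<and>
      (\<Union>i\<le>n. U i) = topspace B}"

text \<open>An open set U of X x X is D-admissible (w.r.t. the base point x0 of X, pi = pi_1(X,x0)):
  for every u in U the image of pi_1(U,u) in pi_1(X x X,u), transported to
  pi_1(X x X,(x0,x0)) = pi x pi along a path delta from u to (x0,x0), lies in a conjugate
  [c] Delta [c]^-1 of the diagonal Delta = {([m],[m])}.\<close>
definition D_admissible :: "'a topology \<Rightarrow> 'a \<Rightarrow> ('a \<times> 'a) set \<Rightarrow> bool" where
  "D_admissible X x0 U \<longleftrightarrow>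
     (\<forall>u\<in>U. \<exists>\<delta> c. pathin (prod_topology X X) \<delta> \<and> \<delta> 0 = u \<and> \<delta> 1 = (x0, x0) \<and>
        loop_at (prod_topology X X) (x0, x0) c \<and>
        (\<forall>l. loop_at (subtopology (prod_topology X X) U) u l \<longrightarrow>
           (\<exists>m. loop_at X x0 m \<and>
              path_homotopic (prod_topology X X)
                 (pjoin (prev c) (pjoin (prev \<delta>) (pjoin l (pjoin \<delta> c))))
                 (\<lambda>t. (m t, m t)))))"

definition TC_D :: "'a topology \<Rightarrow> 'a \<Rightarrow> enat" where
  "TC_D X x0 = Inf {enat k | k. \<exists>U :: nat \<Rightarrow> ('a \<times> 'a) set.
      (\<forall>i\<le>k. openin (prod_topology X X) (U i) \<and> D_admissible X x0 (U i)) \<and>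
      (\<Union>i\<le>k. U i) = topspace (prod_topology X X)}"

end

theory Submission
  imports Defs
begin

text \<open>
  A connected CW H-space has a homotopy inverse: the left translations of X are homotopic to the
  identity, so a map \<iota> together with a homotopy from \<mu>(x, \<iota> x) to e can be constructed cell by cell.
  The map f(x, y) = \<mu>(x, \<iota> y) then induces (\<alpha>, \<beta>) \<mapsto> \<alpha> - \<beta> on fundamental groups, so if the universal
  covering has a section over V, then the preimage of V under f carries only loops whose two
  components are homotopic.
  Conversely, if U is admissible then every loop in the slice {x. (x0, x) \<in> U} is null-homotopic in X,
  and X being locally path connected, the universal covering has a section over the slice.
  Both constructions turn open covers into open covers with the same number of members.

  Instead of computing in fundamental groups, homotopy classes of paths in X are compared through
  the transport between fibres of the universal covering which they define.
\<close>

section \<open>Discs and homotopy extension\<close>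

text \<open>The multiplication need not be homotopy associative, so an inverse cannot be derived by
  algebraic manipulation of \<mu>. It arises as a section of a family of homotopy fibres, those of
  \<mu>(x, -) over e. They are contractible because x can be moved to e, where translation is
  homotopic to the identity. Hence no obstruction appears, and the extension over each cell can be
  written down explicitly. The left unit drives this construction; the right unit is what identifies
  the class of \<mu>(a, \<iota> x0) with that of a. The conjugations in the definition of admissible
  sets cause no trouble in either direction. Acting trivially on every point of a fibre is invariant
  under conjugation, and in the slice the first component of a loop is constant, so that its
  conjugates are null-homotopic.\<close>

lemma continuous_map_compose_on:
  assumes "continuous_map (top_of_set T) X f" and "continuous_on S g" and "g \<in> S \<rightarrow> T"
  shows "continuous_map (top_of_set S) X (\<lambda>x. f (g x))"
proof -
  have "continuous_map (top_of_set S) (top_of_set T) g"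
    using assms by (simp add: continuous_map_in_subtopology image_subset_iff_funcset)
  from continuous_map_compose[OF this assms(1)] show ?thesis
    by (simp add: o_def)
qed

lemma continuous_map_cases_le_on:
  fixes u v :: "'a::topological_space \<Rightarrow> real"
  assumes "continuous_on S u" and "continuous_on S v"
    and "continuous_map (top_of_set {x \<in> S. u x \<le> v x}) X f"
    and "continuous_map (top_of_set {x \<in> S. v x \<le> u x}) X g"
    and "\<And>x. x \<in> S \<Longrightarrow> u x = v x \<Longrightarrow> f x = g x"
  shows "continuous_map (top_of_set S) X (\<lambda>x. if u x \<le> v x then f x else g x)"
proof (rule continuous_map_cases_le)
  have *: "S \<inter> {x \<in> S. P x} = {x \<in> S. P x}" for P
    by blast
  show "continuous_map (subtopology (top_of_set S) {x \<in> topspace (top_of_set S). u x \<le> v x}) X f"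
    "continuous_map (subtopology (top_of_set S) {x \<in> topspace (top_of_set S). v x \<le> u x}) X g"
    using assms(3,4) by (simp_all add: subtopology_subtopology *)
qed (use assms in auto)

section \<open>Euclidean discs inside the countable product of real lines\<close>

definition enorm :: "nat \<Rightarrow> (nat \<Rightarrow> real) \<Rightarrow> real" where
  "enorm n x = sqrt (\<Sum>i<n. (x i)\<^sup>2)"

definition escale :: "real \<Rightarrow> (nat \<Rightarrow> real) \<Rightarrow> nat \<Rightarrow> real" where
  "escale c x = (\<lambda>i. c * x i)"

text \<open>Only finitely many coordinates enter, so this norm is continuous although
  \<open>nat \<Rightarrow> real\<close> carries the product topology.\<close>

lemma continuous_on_enorm [continuous_intros]:
  assumes "continuous_on S f"
  shows "continuous_on S (\<lambda>x. enorm n (f x))"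
  unfolding enorm_def
  by (intro continuous_intros continuous_on_product_then_coordinatewise[OF assms])

lemma continuous_on_escale [continuous_intros]:
  assumes "continuous_on S c" and "continuous_on S f"
  shows "continuous_on S (\<lambda>x. escale (c x) (f x))"
  unfolding escale_def
  by (intro continuous_on_coordinatewise_then_product continuous_on_mult assms(1)
      continuous_on_product_then_coordinatewise[OF assms(2)])

lemma enorm_escale: "0 \<le> c \<Longrightarrow> enorm n (escale c x) = c * enorm n x"
  by (simp add: enorm_def escale_def power_mult_distrib real_sqrt_mult flip: sum_distrib_left)

lemma escale_one [simp]: "escale 1 x = x"
  by (simp add: escale_def)

lemma disc_set_eq: "disc_set n = {x. (\<forall>i\<ge>n. x i = 0) \<and> enorm n x \<le> 1}"
  by (simp add: disc_set_def enorm_def)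

lemma sphere_set_eq: "sphere_set n = {x \<in> disc_set n. enorm n x = 1}"
  by (auto simp: disc_set_def sphere_set_def enorm_def)

lemma open_disc_set_eq: "open_disc_set n = {x \<in> disc_set n. enorm n x < 1}"
  by (auto simp: disc_set_def open_disc_set_def enorm_def)

lemma disc_set_cases: "disc_set n = open_disc_set n \<union> sphere_set n"
  by (auto simp: disc_set_eq open_disc_set_eq sphere_set_eq)

lemma escale_mem_disc_set:
  "x \<in> disc_set n \<Longrightarrow> 0 \<le> c \<Longrightarrow> c * enorm n x \<le> 1 \<Longrightarrow> escale c x \<in> disc_set n"
  by (auto simp: disc_set_eq enorm_escale) (simp add: escale_def)

text \<open>With the disc as a subspace of a type with its own topology, maps given by formulas can
  be treated with \<open>continuous_on\<close>.\<close>

lemma disc_eq: "disc n = top_of_set (disc_set n)"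
proof -
  have "{x. \<forall>i\<ge>n. x i = 0} \<inter> disc_set n = disc_set n"
    by (auto simp: disc_set_def)
  then show ?thesis
    by (simp add: disc_def Euclidean_space_def subtopology_subtopology euclidean_product_topology)
qed

lemma topspace_disc [simp]: "topspace (disc n) = disc_set n"
  by (simp add: disc_eq)

lemma closed_disc_set: "closed (disc_set n)"
proof -
  have eq: "disc_set n = (\<Inter>i\<in>{n..}. {x. x i = 0}) \<inter> {x. enorm n x \<le> 1}"
    by (auto simp: disc_set_eq)
  show ?thesis
    unfolding eq
    by (intro closed_Int closed_INT ballI closed_Collect_eq closed_Collect_le continuous_intros
        continuous_on_product_then_coordinatewise[OF continuous_on_id])
qed

text \<open>The disc is closed in the cube of all sequences with values in [-1, 1], which is compact
  by Tychonoff.\<close>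

lemma compact_space_disc: "compact_space (disc n)"
proof -
  have "\<bar>x i\<bar> \<le> 1" if "x \<in> disc_set n" for x i
  proof (cases "i < n")
    case True
    then have "(x i)\<^sup>2 \<le> (\<Sum>i<n. (x i)\<^sup>2)"
      by (intro member_le_sum) auto
    with that have "(x i)\<^sup>2 \<le> 1"
      by (simp add: disc_set_def)
    then show ?thesis
      by (simp add: abs_square_le_1)
  qed (use that in \<open>simp add: disc_set_def\<close>)
  then have sub: "disc_set n \<subseteq> PiE UNIV (\<lambda>_. {-1..1})"
    by (force simp: abs_le_iff)
  have "compactin (product_topology (\<lambda>_. euclideanreal) (UNIV::nat set)) (PiE UNIV (\<lambda>_. {-1..1}))"
    by (simp add: compactin_PiE)
  then have "compact (PiE (UNIV::nat set) (\<lambda>_. {-1..1::real}))"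
    by (simp add: euclidean_product_topology)
  then have "compact (disc_set n)"
    using closed_disc_set sub compact_Int_closed[of "PiE UNIV (\<lambda>_. {-1..1})" "disc_set n"]
    by (simp add: Int_absorb1)
  then show ?thesis
    by (simp add: disc_eq compact_space_subtopology)
qed

text \<open>The whole product of real lines is contractible and locally path connected, and both
  properties pass to retracts.\<close>

lemma retraction_map_disc:
  "\<exists>r. retraction_map (product_topology (\<lambda>_. euclideanreal) (UNIV :: nat set)) (disc n) r"
proof -
  \<comment> \<open>Coordinates from n on are cut off before the radial projection; the denominator
    leaves points of norm at most 1 in place.\<close>
  define r where "r x = escale (1 / max 1 (enorm n x)) (\<lambda>i. if i < n then x i else 0)"
    for x :: "nat \<Rightarrow> real"
  have en: "enorm n (\<lambda>i. if i < n then x i else 0) = enorm n x" for x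
    by (simp add: enorm_def)
  have r_mem: "r x \<in> disc_set n" for x
  proof -
    have "enorm n (r x) \<le> 1"
      by (auto simp: r_def enorm_escale en field_simps)
    then show ?thesis
      by (simp add: disc_set_eq) (simp add: r_def escale_def)
  qed
  have r_id: "r x = x" if "x \<in> disc_set n" for x
  proof -
    have "(\<lambda>i. if i < n then x i else 0) = x"
      using that by (auto simp: disc_set_eq)
    then show ?thesis
      using that by (auto simp: r_def disc_set_eq max_def)
  qed
  have "continuous_on UNIV (\<lambda>x::nat \<Rightarrow> real. if i < n then x i else 0)" for i
    by (cases "i < n") (auto intro: continuous_on_product_then_coordinatewise[OF continuous_on_id])
  then have "continuous_on UNIV r"
    unfolding r_def
    by (intro continuous_intros continuous_on_coordinatewise_then_product) auto
  with r_mem r_id have "retraction_maps (product_topology (\<lambda>_. euclideanreal) UNIV) (disc n) r id"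
    by (auto simp: retraction_maps_def euclidean_product_topology disc_eq continuous_map_in_subtopology
        continuous_on_id)
  then show ?thesis
    by (auto simp: retraction_map_def)
qed

lemma locally_path_connected_space_disc: "locally_path_connected_space (disc n)"
proof -
  have "locally_path_connected_space (product_topology (\<lambda>_. euclideanreal) (UNIV::nat set))"
    by (simp add: locally_path_connected_space_product_topology
        locally_path_connected_space_euclideanreal contractible_space_euclideanreal
        contractible_imp_path_connected_space)
  then show ?thesis
    using retraction_map_disc locally_path_connected_space_retraction_map_image by blast
qed

lemma contractible_space_disc: "contractible_space (disc n)"
proof -
  have "contractible_space (product_topology (\<lambda>_. euclideanreal) (UNIV::nat set))"
    by (simp add: contractible_space_product_topology contractible_space_euclideanreal)
  then show ?thesis
    using retraction_map_disc contractible_space_retraction_map_image by blast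
qed

text \<open>The pair (B, {N = 1}) has the homotopy extension property: a point (b, u) of
  B \<times> [0,1] is pushed radially away from (0, 2) onto B \<times> {0} \<union> {N = 1} \<times> [0,1].\<close>
lemma gauge_homotopy_extension:
  fixes N :: "'v::topological_space \<Rightarrow> real"
  assumes N: "continuous_on B N" "\<And>b. b \<in> B \<Longrightarrow> N b \<le> 1"
    and sc: "continuous_on (UNIV \<times> B) (\<lambda>(c, b). sc c b)" "\<And>b. sc 1 b = b"
      "\<And>c b. b \<in> B \<Longrightarrow> 0 \<le> c \<Longrightarrow> c * N b \<le> 1 \<Longrightarrow> sc c b \<in> B \<and> N (sc c b) = c * N b"
    and f: "continuous_map (top_of_set B) X f"
    and h: "continuous_map (top_of_set ({b \<in> B. N b = 1} \<times> {0..1::real})) X h"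
    and fh: "\<And>b. b \<in> B \<Longrightarrow> N b = 1 \<Longrightarrow> h (b, 0) = f b"
  obtains g where "continuous_map (top_of_set (B \<times> {0..1})) X g"
    "\<And>b. b \<in> B \<Longrightarrow> g (b, 0) = f b"
    "\<And>b u. b \<in> B \<Longrightarrow> N b = 1 \<Longrightarrow> u \<in> {0..1} \<Longrightarrow> g (b, u) = h (b, u)"
proof -
  let ?S = "B \<times> {0..1::real}"
  let ?u = "\<lambda>z. 2 * N (fst z)" and ?v = "\<lambda>z. 2 - snd z"
  \<comment> \<open>The ray from (0, 2) through (b, u) consists of the points (s b, 2 - s (2 - u)).
    It meets height 0 at s = 2 / (2 - u) and the side N = 1 at s = 1 / N b; comparing these
    parameters gives the case distinction.\<close>
  define g where "g z = (if ?u z \<le> ?v z then f (sc (2 / (2 - snd z)) (fst z))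
     else h (sc (1 / N (fst z)) (fst z), 2 - (2 - snd z) / N (fst z)))" for z
  have sc': "continuous_on T (\<lambda>z. sc (c z) (b z))"
    if "continuous_on T c" "continuous_on T b" "b \<in> T \<rightarrow> B" for T :: "('v \<times> real) set" and c b
    using continuous_on_compose2[OF sc(1), of T "\<lambda>z. (c z, b z)"] that
    by (auto intro: continuous_intros)
  have Nf: "continuous_on T (\<lambda>z. N (fst z))" if "T \<subseteq> ?S" for T
    by (rule continuous_on_compose2[OF N(1)]) (use that in \<open>auto intro: continuous_intros\<close>)
  show thesis
  proof
    show "continuous_map (top_of_set ?S) X g"
      unfolding g_def
    proof (rule continuous_map_cases_le_on)
      show "continuous_map (top_of_set {z \<in> ?S. ?u z \<le> ?v z}) X (\<lambda>z. f (sc (2 / (2 - snd z)) (fst z)))"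
        by (rule continuous_map_compose_on[OF f])
          (auto intro!: sc' continuous_intros sc(3)[THEN conjunct1] simp: field_simps)
      show "continuous_map (top_of_set {z \<in> ?S. ?v z \<le> ?u z}) X
         (\<lambda>z. h (sc (1 / N (fst z)) (fst z), 2 - (2 - snd z) / N (fst z)))"
      proof (rule continuous_map_compose_on[OF h])
        \<comment> \<open>In this branch 2 N b is at least 2 - u, hence at least 1, which keeps the
          division by N b away from the centre.\<close>
        have pos: "N b > 0" if "u \<le> 1" "2 - u \<le> 2 * N b" for b and u :: real
          using that by linarith
        show "continuous_on {z \<in> ?S. ?v z \<le> ?u z}
            (\<lambda>z. (sc (1 / N (fst z)) (fst z), 2 - (2 - snd z) / N (fst z)))"
          by (intro continuous_intros sc' Nf) (use pos in force)+
        have "sc (1 / N b) b \<in> B \<and> N (sc (1 / N b) b) = 1 \<and> 0 \<le> 2 - (2 - u) / N b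
            \<and> 2 - (2 - u) / N b \<le> 1"
          if "b \<in> B" "0 \<le> u" "u \<le> 1" "2 - u \<le> 2 * N b" for b and u :: real
          using that pos[of u b] sc(3)[of b "1 / N b"] N(2)[of b] by (simp add: field_simps)
        then show "(\<lambda>z. (sc (1 / N (fst z)) (fst z), 2 - (2 - snd z) / N (fst z)))
            \<in> {z \<in> ?S. ?v z \<le> ?u z} \<rightarrow> {b \<in> B. N b = 1} \<times> {0..1}"
          by auto
      qed
      show "f (sc (2 / (2 - snd z)) (fst z)) =
          h (sc (1 / N (fst z)) (fst z), 2 - (2 - snd z) / N (fst z))"
        if z: "z \<in> ?S" and eq: "?u z = ?v z" for z
      proof -
        have "N (fst z) > 0" using z eq by auto
        moreover from this have "2 / (2 - snd z) = 1 / N (fst z)" "(2 - snd z) / N (fst z) = 2"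
          using eq[symmetric] by (simp_all add: field_simps)
        ultimately show ?thesis
          using z sc(3)[of "fst z" "1 / N (fst z)"] fh by auto
      qed
    qed (auto intro!: continuous_intros Nf)
    show "g (b, 0) = f b" if "b \<in> B" for b
      using that N(2)[of b] by (simp add: g_def sc)
    show "g (b, u) = h (b, u)" if "b \<in> B" "N b = 1" "u \<in> {0..1}" for b u
      using that fh[of b] by (auto simp: g_def sc)
  qed
qed

section \<open>CW complexes\<close>

text \<open>Injectivity on open discs, together with disjointness of the open cells, lets a map on X
  be defined at a point from its unique cell and its unique preimage in the open disc.\<close>

locale cw_structure =
  fixes X :: "'a topology" and C :: "(nat \<times> ((nat \<Rightarrow> real) \<Rightarrow> 'a)) set"
  assumes Hausdorff: "Hausdorff_space X"
    and continuous_cell: "(n, \<Phi>) \<in> C \<Longrightarrow> continuous_map (disc n) X \<Phi>"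
    and inj_cell: "(n, \<Phi>) \<in> C \<Longrightarrow> inj_on \<Phi> (open_disc_set n)"
    and boundary_cell: "(n, \<Phi>) \<in> C \<Longrightarrow> \<exists>F. finite F \<and> F \<subseteq> C \<and> (\<forall>(m, \<Psi>)\<in>F. m < n) \<and>
               \<Phi> ` sphere_set n \<subseteq> (\<Union>(m, \<Psi>)\<in>F. \<Psi> ` open_disc_set m)"
    and disjoint_cells: "c \<in> C \<Longrightarrow> d \<in> C \<Longrightarrow> c \<noteq> d \<Longrightarrow>
          disjnt (snd c ` open_disc_set (fst c)) (snd d ` open_disc_set (fst d))"
    and cells_cover: "topspace X = (\<Union>(n, \<Phi>)\<in>C. \<Phi> ` open_disc_set n)"
    and weak_topology: "A \<subseteq> topspace X \<Longrightarrow> closedin X A \<longleftrightarrow>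
          (\<forall>(n, \<Phi>)\<in>C. closedin (disc n) {x \<in> topspace (disc n). \<Phi> x \<in> A})"

lemma cw_complex_structure:
  assumes "cw_complex X"
  obtains C where "cw_structure X C"
proof -
  obtain C :: "(nat \<times> ((nat \<Rightarrow> real) \<Rightarrow> 'a)) set" where C: "Hausdorff_space X"
       "\<forall>(n,\<Phi>)\<in>C.
          continuous_map (disc n) X \<Phi> \<and>
          homeomorphic_map (subtopology (disc n) (open_disc_set n))
                           (subtopology X (\<Phi> ` open_disc_set n)) \<Phi> \<and>
          (\<exists>F. finite F \<and> F \<subseteq> C \<and> (\<forall>(m,\<Psi>)\<in>F. m < n) \<and>
               \<Phi> ` sphere_set n \<subseteq> (\<Union>(m,\<Psi>)\<in>F. \<Psi> ` open_disc_set m))"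
       "\<forall>c\<in>C. \<forall>d\<in>C. c \<noteq> d \<longrightarrow>
          disjnt (snd c ` open_disc_set (fst c)) (snd d ` open_disc_set (fst d))"
       "topspace X = (\<Union>(n,\<Phi>)\<in>C. \<Phi> ` open_disc_set n)"
       "\<forall>A\<subseteq>topspace X. closedin X A \<longleftrightarrow>
          (\<forall>(n,\<Phi>)\<in>C. closedin (disc n) {x \<in> topspace (disc n). \<Phi> x \<in> A})"
    using assms unfolding cw_complex_def by (elim conjE exE) (rule that; assumption)
  have "inj_on \<Phi> (open_disc_set n)" if "(n, \<Phi>) \<in> C" for n \<Phi>
  proof -
    have "homeomorphic_map (subtopology (disc n) (open_disc_set n))
            (subtopology X (\<Phi> ` open_disc_set n)) \<Phi>"
      using C(2) that by auto
    moreover have "disc_set n \<inter> open_disc_set n = open_disc_set n"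
      by (auto simp: disc_set_cases)
    ultimately show ?thesis
      by (auto dest!: homeomorphic_imp_injective_map)
  qed
  note inj = this
  have "cw_structure X C"
  proof
    show "continuous_map (disc n) X \<Phi>" if "(n, \<Phi>) \<in> C" for n \<Phi>
      using bspec[OF C(2) that] by simp
    show "\<exists>F. finite F \<and> F \<subseteq> C \<and> (\<forall>(m,\<Psi>)\<in>F. m < n) \<and>
        \<Phi> ` sphere_set n \<subseteq> (\<Union>(m,\<Psi>)\<in>F. \<Psi> ` open_disc_set m)" if "(n, \<Phi>) \<in> C" for n \<Phi>
      using bspec[OF C(2) that] by simp
  qed (use C inj in simp_all)
  with that show thesis .
qed

context cw_structure
begin

text \<open>The weak topology is rephrased by a single quotient map, because local path
  connectedness and continuity tests pass through quotient maps.\<close>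

lemma quotient_map_cells:
  "quotient_map (sum_topology (\<lambda>c. disc (fst c)) C) X (\<lambda>(c, x). snd c x)"
  unfolding quotient_map_closedin
proof (intro conjI allI impI)
  have "snd c x \<in> topspace X" if "c \<in> C" "x \<in> disc_set (fst c)" for c x
    using continuous_cell[of "fst c" "snd c"] that by (force simp: continuous_map_def)
  moreover have "\<exists>c\<in>C. y \<in> snd c ` disc_set (fst c)" if "y \<in> topspace X" for y
    using that by (force simp: cells_cover disc_set_cases)
  ultimately show "(\<lambda>(c, x). snd c x) ` topspace (sum_topology (\<lambda>c. disc (fst c)) C) = topspace X"
    by (force simp: image_iff)
next
  fix U assume U: "U \<subseteq> topspace X"
  have "{x. (c, x) \<in> {x \<in> topspace (sum_topology (\<lambda>c. disc (fst c)) C). (case x of (c, x) \<Rightarrow> snd c x) \<in> U}}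
      = {x \<in> disc_set (fst c). snd c x \<in> U}" if "c \<in> C" for c
    using that by auto
  then have "closedin (sum_topology (\<lambda>c. disc (fst c)) C)
      {x \<in> topspace (sum_topology (\<lambda>c. disc (fst c)) C). (case x of (c, x) \<Rightarrow> snd c x) \<in> U} \<longleftrightarrow>
      (\<forall>c\<in>C. closedin (disc (fst c)) {x \<in> disc_set (fst c). snd c x \<in> U})"
    unfolding closedin_sum_topology by auto
  also have "\<dots> \<longleftrightarrow> closedin X U"
    using weak_topology[OF U] by (simp add: case_prod_unfold)
  finally show "closedin (sum_topology (\<lambda>c. disc (fst c)) C)
      {x \<in> topspace (sum_topology (\<lambda>c. disc (fst c)) C). (case x of (c, x) \<Rightarrow> snd c x) \<in> U}
      = closedin X U" .
qed

lemma locally_path_connected: "locally_path_connected_space X"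
  by (rule locally_path_connected_space_quotient_map_image[OF quotient_map_cells])
    (simp add: locally_path_connected_space_sum_topology locally_path_connected_space_disc)

text \<open>The product of a quotient map with the identity of a locally compact Hausdorff space is
  again a quotient map; this allows homotopies, and not only maps, to be tested on cells.\<close>

lemma continuous_map_cellwise:
  assumes Z: "compact_space Z" "Hausdorff_space Z"
    and k: "\<And>n \<Phi>. (n, \<Phi>) \<in> C \<Longrightarrow> continuous_map (prod_topology (disc n) Z) Y (\<lambda>(d, t). k (\<Phi> d, t))"
  shows "continuous_map (prod_topology X Z) Y k"
proof (rule continuous_compose_quotient_map)
  show "quotient_map (prod_topology (sum_topology (\<lambda>c. disc (fst c)) C) Z) (prod_topology X Z)
      (\<lambda>(x, t). ((\<lambda>(c, x). snd c x) x, t))"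
    by (rule quotient_map_prod_left[OF _ _ quotient_map_cells])
      (use Z in \<open>auto simp: compact_imp_locally_compact_space\<close>)
  let ?S = "sum_topology (\<lambda>c. disc (fst c)) C"
  let ?T = "\<lambda>c. ({c} \<times> disc_set (fst c)) \<times> topspace Z"
  show "continuous_map (prod_topology ?S Z) Y (k \<circ> (\<lambda>(x, t). ((\<lambda>(c, x). snd c x) x, t)))"
  proof (rule pasting_lemma[where I = C and T = ?T and
        f = "\<lambda>_. (k \<circ> (\<lambda>(x, t). ((\<lambda>(c, x). snd c x) x, t)))"])
    fix c assume c: "c \<in> C"
    have op: "openin ?S ({c} \<times> U)" if U: "openin (disc (fst c)) U" for U
      unfolding openin_sum_topology
    proof (intro conjI ballI)
      show "{c} \<times> U \<subseteq> Sigma C (topspace \<circ> (\<lambda>c. disc (fst c)))"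
        using c openin_subset[OF U] by auto
      fix i assume "i \<in> C"
      show "openin (disc (fst i)) {x. (i, x) \<in> {c} \<times> U}"
        using U by (cases "i = c") simp_all
    qed
    have op_disc: "openin ?S ({c} \<times> disc_set (fst c))"
      using op openin_topspace[of "disc (fst c)"] by simp
    then show "openin (prod_topology ?S Z) (?T c)"
      by (simp add: openin_prod_Times_iff)
    have "continuous_map (subtopology ?S ({c} \<times> disc_set (fst c))) (disc (fst c)) snd"
      unfolding continuous_map_def
    proof (intro conjI allI impI)
      fix U assume U: "openin (disc (fst c)) U"
      then have "U \<subseteq> disc_set (fst c)"
        using openin_subset by fastforce
      then have eq: "{x \<in> topspace (subtopology ?S ({c} \<times> disc_set (fst c))). snd x \<in> U} = {c} \<times> U"
        using c by auto
      show "openin (subtopology ?S ({c} \<times> disc_set (fst c)))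
          {x \<in> topspace (subtopology ?S ({c} \<times> disc_set (fst c))). snd x \<in> U}"
        unfolding eq using \<open>U \<subseteq> disc_set (fst c)\<close> op[OF U] op_disc
        by (subst openin_open_subtopology) auto
    qed auto
    then have "continuous_map (subtopology (prod_topology ?S Z) (?T c)) (prod_topology (disc (fst c)) Z)
        (\<lambda>z. (snd (fst z), snd z))"
      using continuous_map_prod_top[of "subtopology ?S ({c} \<times> disc_set (fst c))" Z "disc (fst c)" Z snd id]
      by (simp add: prod_topology_subtopology case_prod_unfold)
    from continuous_map_compose[OF this k[of "fst c" "snd c"]] c
    show "continuous_map (subtopology (prod_topology ?S Z) (?T c)) Y
        (k \<circ> (\<lambda>(x, t). ((\<lambda>(c, x). snd c x) x, t)))"
      by (auto elim!: continuous_map_eq)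
  qed auto
qed

text \<open>The bound is strict: this is the usual skeleton of dimension n - 1, so
  \<open>skeleton 0\<close> is empty and the boundary of an n-cell lies in
  \<open>skeleton n\<close>.\<close>

definition skeleton :: "nat \<Rightarrow> 'a set" where
  "skeleton n = (\<Union>(m, \<Phi>)\<in>{c \<in> C. fst c < n}. \<Phi> ` open_disc_set m)"

lemma skeleton_mono: "m \<le> n \<Longrightarrow> skeleton m \<subseteq> skeleton n"
  by (fastforce simp: skeleton_def)

lemma cell_sphere_skeleton:
  assumes "(n, \<Phi>) \<in> C" "d \<in> sphere_set n"
  shows "\<Phi> d \<in> skeleton n"
proof -
  obtain F where F: "F \<subseteq> C" "\<forall>(m, \<Psi>)\<in>F. m < n"
      "\<Phi> ` sphere_set n \<subseteq> (\<Union>(m, \<Psi>)\<in>F. \<Psi> ` open_disc_set m)"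
    using boundary_cell[OF assms(1)] by blast
  then have "\<Phi> d \<in> (\<Union>(m, \<Psi>)\<in>F. \<Psi> ` open_disc_set m)"
    using assms(2) by blast
  moreover have "F \<subseteq> {c \<in> C. fst c < n}"
    using F(1,2) by auto
  ultimately show ?thesis
    unfolding skeleton_def by blast
qed

lemma cell_disc_skeleton:
  assumes "(m, \<Phi>) \<in> C" "d \<in> disc_set m" "m < n"
  shows "\<Phi> d \<in> skeleton n"
  using assms(2) unfolding disc_set_cases
proof
  assume "d \<in> open_disc_set m"
  with assms show ?thesis by (force simp: skeleton_def)
next
  assume "d \<in> sphere_set m"
  with assms show ?thesis
    using cell_sphere_skeleton skeleton_mono[of m n] by (metis less_imp_le subsetD)
qed

lemma cell_open_not_skeleton:
  assumes "(n, \<Phi>) \<in> C" "d \<in> open_disc_set n"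
  shows "\<Phi> d \<notin> skeleton n"
proof
  assume "\<Phi> d \<in> skeleton n"
  then obtain c where "c \<in> C" "fst c < n" "\<Phi> d \<in> snd c ` open_disc_set (fst c)"
    by (auto simp: skeleton_def)
  moreover from this have "(n, \<Phi>) \<noteq> c" by auto
  ultimately have "disjnt (\<Phi> ` open_disc_set n) (snd c ` open_disc_set (fst c))"
    using disjoint_cells[of "(n, \<Phi>)" c] assms(1) by simp
  with assms(2) \<open>\<Phi> d \<in> snd c ` open_disc_set (fst c)\<close> show False
    by (meson disjnt_iff imageI)
qed

text \<open>No topology is put on the skeleton itself. Continuity on the sphere is pasted from
  finitely many closed pieces: the boundary lies in finitely many lower cells, the images of their
  discs are compact and hence closed, and each disc times Z is a quotient onto its image times
  Z.\<close>

lemma continuous_map_attaching: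
  assumes Z: "compact_space Z" "Hausdorff_space Z"
    and k: "\<And>m \<Psi>. (m, \<Psi>) \<in> C \<Longrightarrow> m < n \<Longrightarrow>
        continuous_map (prod_topology (disc m) Z) Y (\<lambda>(d, t). k (\<Psi> d, t))"
    and cell: "(n, \<Phi>) \<in> C"
  shows "continuous_map (prod_topology (subtopology (disc n) (sphere_set n)) Z) Y (\<lambda>(d, t). k (\<Phi> d, t))"
proof -
  obtain F where F: "finite F" "F \<subseteq> C" "\<forall>(m, \<Psi>)\<in>F. m < n"
      "\<Phi> ` sphere_set n \<subseteq> (\<Union>(m, \<Psi>)\<in>F. \<Psi> ` open_disc_set m)"
    using boundary_cell[OF cell] by blast
  let ?K = "\<lambda>c. snd c ` disc_set (fst c)"
  have K: "closedin X (?K c) \<and> continuous_map (prod_topology (subtopology X (?K c)) Z) Y k"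
    if "c \<in> F" for c
  proof -
    obtain m \<Psi> where c: "c = (m, \<Psi>)" by force
    with that F have m: "(m, \<Psi>) \<in> C" "m < n" by auto
    have "compactin X (?K c)"
      using image_compactin[OF _ continuous_cell[OF m(1)], of "disc_set m"] compact_space_disc[of m]
      by (simp add: c compact_space_def)
    then have clo: "closedin X (?K c)"
      by (rule compactin_imp_closedin[OF Hausdorff])
    then have top: "topspace (subtopology X (?K c)) = ?K c"
      using closedin_subset by auto
    have cont: "continuous_map (disc m) (subtopology X (?K c)) \<Psi>"
      using continuous_cell[OF m(1)] by (auto simp: c continuous_map_in_subtopology)
    have "quotient_map (prod_topology (disc m) Z) (prod_topology (subtopology X (?K c)) Z)
        (\<lambda>(d, t). (\<Psi> d, t))"
    proof (rule continuous_imp_quotient_map)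
      show "continuous_map (prod_topology (disc m) Z) (prod_topology (subtopology X (?K c)) Z)
          (\<lambda>(d, t). (\<Psi> d, t))"
        using continuous_map_prod_top[of "disc m" Z "subtopology X (?K c)" Z \<Psi> id] cont by simp
      show "(\<lambda>(d, t). (\<Psi> d, t)) ` topspace (prod_topology (disc m) Z) =
          topspace (prod_topology (subtopology X (?K c)) Z)"
        unfolding topspace_prod_topology top by (force simp: c)
    qed (use Z in \<open>auto simp: compact_space_prod_topology Hausdorff_space_prod_topology
        compact_space_disc Hausdorff_space_subtopology Hausdorff\<close>)
    then have "continuous_map (prod_topology (subtopology X (?K c)) Z) Y k"
      by (rule continuous_compose_quotient_map) (use k[OF m] in \<open>simp add: o_def case_prod_unfold\<close>)
    with clo show ?thesis by blast
  qed
  let ?S = "prod_topology (subtopology (disc n) (sphere_set n)) Z"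
  have cont: "continuous_map ?S (prod_topology X Z) (\<lambda>(d, t). (\<Phi> d, t))"
    using continuous_map_prod_top[of "subtopology (disc n) (sphere_set n)" Z X Z \<Phi> id]
      continuous_cell[OF cell] by (simp add: continuous_map_from_subtopology)
  show ?thesis
  proof (rule pasting_lemma_closed[OF F(1), where f = "\<lambda>_. (\<lambda>(d, t). k (\<Phi> d, t))" and
        T = "\<lambda>c. {z \<in> topspace ?S. (\<lambda>(d, t). (\<Phi> d, t)) z \<in> ?K c \<times> topspace Z}"])
    fix c assume c: "c \<in> F"
    have "closedin (prod_topology X Z) (?K c \<times> topspace Z)"
      using K[OF c] by (simp add: closedin_prod_Times_iff)
    from closedin_continuous_map_preimage[OF cont this]
    show "closedin ?S {z \<in> topspace ?S. (\<lambda>(d, t). (\<Phi> d, t)) z \<in> ?K c \<times> topspace Z}" .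
    have "continuous_map (subtopology ?S {z \<in> topspace ?S. (\<lambda>(d, t). (\<Phi> d, t)) z \<in> ?K c \<times> topspace Z})
        (prod_topology (subtopology X (?K c)) Z) (\<lambda>(d, t). (\<Phi> d, t))"
      unfolding prod_topology_subtopology
      by (intro continuous_map_into_subtopology continuous_map_from_subtopology
          cont[unfolded prod_topology_subtopology]) auto
    from continuous_map_compose[OF this conjunct2[OF K[OF c]]]
    show "continuous_map (subtopology ?S {z \<in> topspace ?S. (\<lambda>(d, t). (\<Phi> d, t)) z \<in> ?K c \<times> topspace Z})
        Y (\<lambda>(d, t). k (\<Phi> d, t))"
      by (simp add: o_def case_prod_unfold)
  next
    fix z assume z: "z \<in> topspace ?S"
    then obtain c where "c \<in> F" "\<Phi> (fst z) \<in> snd c ` open_disc_set (fst c)"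
      using F(4) by (auto simp: subset_iff)
    with z show "\<exists>c. c \<in> F \<and>
        z \<in> {z \<in> topspace ?S. (\<lambda>(d, t). (\<Phi> d, t)) z \<in> ?K c \<times> topspace Z} \<and>
        (\<lambda>(d, t). k (\<Phi> d, t)) z = (\<lambda>(d, t). k (\<Phi> d, t)) z"
      by (intro exI[of _ c]) (auto simp: disc_set_cases)
  qed auto
qed

text \<open>The predicate \<open>R\<close> constrains the whole slice over a point, so that sections
  of a family are produced and not merely maps; with Z the unit interval, a slice is a path.
  \<open>R_cong\<close> is there because the values of a slice outside \<open>topspace Z\<close> are
  arbitrary.\<close>

theorem cellwise_extension:
  fixes Z :: "'z topology" and Y :: "'y topology" and R :: "'a \<Rightarrow> ('z \<Rightarrow> 'y) \<Rightarrow> bool"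
  assumes Z: "compact_space Z" "Hausdorff_space Z"
    and R_cong: "\<And>x g g'. (\<And>t. t \<in> topspace Z \<Longrightarrow> g t = g' t) \<Longrightarrow> R x g \<Longrightarrow> R x g'"
    and ext: "\<And>n \<Phi> k. continuous_map (disc n) X \<Phi> \<Longrightarrow>
       continuous_map (prod_topology (subtopology (disc n) (sphere_set n)) Z) Y k \<Longrightarrow>
       (\<And>d. d \<in> sphere_set n \<Longrightarrow> R (\<Phi> d) (\<lambda>t. k (d, t))) \<Longrightarrow>
       \<exists>k'. continuous_map (prod_topology (disc n) Z) Y k' \<and>
         (\<forall>d\<in>sphere_set n. \<forall>t\<in>topspace Z. k' (d, t) = k (d, t)) \<and>
         (\<forall>d\<in>disc_set n. R (\<Phi> d) (\<lambda>t. k' (d, t)))"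
  obtains k where "continuous_map (prod_topology X Z) Y k"
    "\<And>x. x \<in> topspace X \<Longrightarrow> R x (\<lambda>t. k (x, t))"
proof -
  \<comment> \<open>Conditions are imposed cell by cell, in dimensions below n only; elsewhere k is
    an arbitrary total function.\<close>
  define good where "good n k \<longleftrightarrow> (\<forall>(m, \<Phi>)\<in>C. m < n \<longrightarrow>
      continuous_map (prod_topology (disc m) Z) Y (\<lambda>(d, t). k (\<Phi> d, t)) \<and>
      (\<forall>d\<in>disc_set m. R (\<Phi> d) (\<lambda>t. k (\<Phi> d, t))))" for n and k :: "'a \<times> 'z \<Rightarrow> 'y"
  have step: "\<exists>k'. good (Suc n) k' \<and> (\<forall>x\<in>skeleton n. \<forall>t. k' (x, t) = k (x, t))"
    if good: "good n k" for n k
  proof -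
    have "\<exists>K. continuous_map (prod_topology (disc n) Z) Y K \<and>
         (\<forall>d\<in>sphere_set n. \<forall>t\<in>topspace Z. K (d, t) = k (\<Phi> d, t)) \<and>
         (\<forall>d\<in>disc_set n. R (\<Phi> d) (\<lambda>t. K (d, t)))" if cell: "(n, \<Phi>) \<in> C" for \<Phi>
    proof -
      have "R (\<Phi> d) (\<lambda>t. k (\<Phi> d, t))" if d: "d \<in> sphere_set n" for d
      proof -
        obtain m \<Psi> d' where "(m, \<Psi>) \<in> C" "m < n" "d' \<in> open_disc_set m" "\<Phi> d = \<Psi> d'"
          using cell_sphere_skeleton[OF cell d] by (auto simp: skeleton_def)
        with good show ?thesis
          by (force simp: good_def disc_set_cases)
      qed
      moreover have "continuous_map (prod_topology (subtopology (disc n) (sphere_set n)) Z) Y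
          (\<lambda>(d, t). k (\<Phi> d, t))"
        using good by (intro continuous_map_attaching[OF Z _ cell]) (auto simp: good_def)
      ultimately show ?thesis
        using ext[OF continuous_cell[OF cell], of "\<lambda>(d, t). k (\<Phi> d, t)"] by simp
    qed
    then obtain K where K: "\<And>\<Phi>. (n, \<Phi>) \<in> C \<Longrightarrow> continuous_map (prod_topology (disc n) Z) Y (K \<Phi>)"
      "\<And>\<Phi> d t. (n, \<Phi>) \<in> C \<Longrightarrow> d \<in> sphere_set n \<Longrightarrow> t \<in> topspace Z \<Longrightarrow> K \<Phi> (d, t) = k (\<Phi> d, t)"
      "\<And>\<Phi> d. (n, \<Phi>) \<in> C \<Longrightarrow> d \<in> disc_set n \<Longrightarrow> R (\<Phi> d) (\<lambda>t. K \<Phi> (d, t))"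
      by metis
    \<comment> \<open>An inverse of all characteristic maps of open n-cells at once, single-valued
      by disjointness and injectivity.\<close>
    define sel where
      "sel x = (SOME c. (n, fst c) \<in> C \<and> snd c \<in> open_disc_set n \<and> x = fst c (snd c))" for x
    have sel: "sel (\<Phi> d) = (\<Phi>, d)" if "(n, \<Phi>) \<in> C" "d \<in> open_disc_set n" for \<Phi> d
      unfolding sel_def
    proof (rule some_equality)
      fix c assume c: "(n, fst c) \<in> C \<and> snd c \<in> open_disc_set n \<and> \<Phi> d = fst c (snd c)"
      with disjoint_cells[of "(n, fst c)" "(n, \<Phi>)"] that have "fst c = \<Phi>"
        by (auto simp: disjnt_iff)
      with c inj_cell[OF that(1)] that show "c = (\<Phi>, d)"
        by (auto simp: inj_on_def prod_eq_iff)
    qed (use that in auto)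
    define k' where "k' z = (if fst z \<in> skeleton n then k z
        else K (fst (sel (fst z))) (snd (sel (fst z)), snd z))" for z
    have k'_eq: "k' (\<Phi> d, t) = K \<Phi> (d, t)" if "(n, \<Phi>) \<in> C" "d \<in> disc_set n" "t \<in> topspace Z" for \<Phi> d t
    proof (cases "d \<in> open_disc_set n")
      case True
      then show ?thesis
        using that cell_open_not_skeleton sel by (simp add: k'_def)
    next
      case False
      with that have "d \<in> sphere_set n" by (simp add: disc_set_cases)
      then show ?thesis
        using that cell_sphere_skeleton K(2) by (simp add: k'_def)
    qed
    have "good (Suc n) k'"
      unfolding good_def
    proof clarify
      fix m \<Phi> assume m: "(m, \<Phi>) \<in> C" "m < Suc n"
      show "continuous_map (prod_topology (disc m) Z) Y (\<lambda>(d, t). k' (\<Phi> d, t)) \<and>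
          (\<forall>d\<in>disc_set m. R (\<Phi> d) (\<lambda>t. k' (\<Phi> d, t)))"
      proof (cases "m = n")
        case True
        with m have "(n, \<Phi>) \<in> C" by simp
        with True K(1,3)[OF this] k'_eq[OF this] show ?thesis
          by (auto elim!: continuous_map_eq intro: R_cong)
      next
        case False
        with m have "m < n" by simp
        then have "k' (\<Phi> d, t) = k (\<Phi> d, t)" if "d \<in> disc_set m" for d t
          using cell_disc_skeleton[OF m(1) that] by (simp add: k'_def)
        moreover have "continuous_map (prod_topology (disc m) Z) Y (\<lambda>(d, t). k (\<Phi> d, t))"
          "\<forall>d\<in>disc_set m. R (\<Phi> d) (\<lambda>t. k (\<Phi> d, t))"
          using good m(1) \<open>m < n\<close> by (auto simp: good_def)
        ultimately show ?thesis
          by (auto elim!: continuous_map_eq)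
      qed
    qed
    then show ?thesis
      by (intro exI[of _ k']) (auto simp: k'_def)
  qed
  obtain k where k: "\<And>n. good n (k n)" "\<And>n x t. x \<in> skeleton n \<Longrightarrow> k (Suc n) (x, t) = k n (x, t)"
  proof -
    have "\<exists>k. good 0 k"
      by (auto simp: good_def)
    from dependent_nat_choice[of good "\<lambda>n k k'. \<forall>x\<in>skeleton n. \<forall>t. k' (x, t) = k (x, t)", OF this step]
    show ?thesis
      using that by blast
  qed
  have k_stable: "k (n + j) (x, t) = k n (x, t)" if "x \<in> skeleton n" for n j x t
    using that skeleton_mono[of n "n + _"] by (induction j) (auto simp: k(2) subset_iff)
  \<comment> \<open>Later stages leave earlier skeleta untouched, so the limit can be read off at
    the first stage that contains the point.\<close>
  define lev where "lev x = (LEAST n. x \<in> skeleton n)" for x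
  define klim where "klim z = k (lev (fst z)) z" for z
  have k_lim: "klim (x, t) = k n (x, t)" if "x \<in> skeleton n" for n x t
  proof -
    have "lev x \<le> n" "x \<in> skeleton (lev x)"
      using that by (auto simp: lev_def intro: Least_le LeastI)
    then show ?thesis
      using k_stable[of x "lev x" "n - lev x" t] by (simp add: klim_def)
  qed
  \<comment> \<open>A closed m-cell lies in the union of the open cells of dimension at most m,
    hence the stage \<open>Suc m\<close>.\<close>
  have k_cell: "klim (\<Phi> d, t) = k (Suc m) (\<Phi> d, t)" if "(m, \<Phi>) \<in> C" "d \<in> disc_set m" for m \<Phi> d t
    using that by (intro k_lim cell_disc_skeleton) auto
  have good_lim: "good n klim" for n
    unfolding good_def
  proof clarify
    fix m \<Phi> assume m: "(m, \<Phi>) \<in> C" "m < n"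
    have "continuous_map (prod_topology (disc m) Z) Y (\<lambda>(d, t). k (Suc m) (\<Phi> d, t)) \<and>
          (\<forall>d\<in>disc_set m. R (\<Phi> d) (\<lambda>t. k (Suc m) (\<Phi> d, t)))"
      using k(1)[of "Suc m"] m(1) by (auto simp: good_def)
    with k_cell[OF m(1)] show "continuous_map (prod_topology (disc m) Z) Y (\<lambda>(d, t). klim (\<Phi> d, t)) \<and>
          (\<forall>d\<in>disc_set m. R (\<Phi> d) (\<lambda>t. klim (\<Phi> d, t)))"
      by (auto elim!: continuous_map_eq)
  qed
  show thesis
  proof
    show "continuous_map (prod_topology X Z) Y klim"
      by (rule continuous_map_cellwise[OF Z]) (use good_lim in \<open>auto simp: good_def\<close>)
    fix x assume "x \<in> topspace X"
    then obtain n \<Phi> d where "(n, \<Phi>) \<in> C" "d \<in> open_disc_set n" "x = \<Phi> d"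
      by (auto simp: cells_cover)
    then show "R x (\<lambda>t. klim (x, t))"
      using good_lim[of "Suc n"] by (force simp: good_def disc_set_cases)
  qed
qed

end

section \<open>Homotopy inverses of H-spaces\<close>

text \<open>If the maps L(d, -) : X \<rightarrow> X are all homotopic to the identity, compatibly in d, then the
  homotopy fibres of L(d, -) over e are contractible; so a section (y, h) of them over the
  boundary of the disc extends.  First y is extended along the path from y(s) to e obtained from
  the homotopy and h; the resulting h then agrees with the given one on the boundary only up to
  the cancellation of a path with its reverse, which the homotopy extension property of
  (D \<times> [0,1], boundary) repairs.\<close>
lemma disc_section_extension:
  fixes L :: "(nat \<Rightarrow> real) \<times> 'a \<Rightarrow> 'a"
  assumes L: "homotopic_with (\<lambda>_. True) (prod_topology (disc n) X) X L snd"
    and e: "e \<in> topspace X"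
    and y: "continuous_map (top_of_set (sphere_set n)) X y"
    and h: "continuous_map (top_of_set (sphere_set n \<times> {0..1::real})) X h"
    and h0: "\<And>s. s \<in> sphere_set n \<Longrightarrow> h (s, 0) = L (s, y s)"
    and h1: "\<And>s. s \<in> sphere_set n \<Longrightarrow> h (s, 1) = e"
  obtains y' h' where "continuous_map (top_of_set (disc_set n)) X y'"
    "continuous_map (top_of_set (disc_set n \<times> {0..1::real})) X h'"
    "\<And>s. s \<in> sphere_set n \<Longrightarrow> y' s = y s"
    "\<And>s t. s \<in> sphere_set n \<Longrightarrow> t \<in> {0..1} \<Longrightarrow> h' (s, t) = h (s, t)"
    "\<And>d. d \<in> disc_set n \<Longrightarrow> h' (d, 0) = L (d, y' d)"
    "\<And>d. d \<in> disc_set n \<Longrightarrow> h' (d, 1) = e"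
proof -
  let ?D = "disc_set n" and ?S = "sphere_set n" and ?I = "{0..1::real}"
  have SD: "?S \<subseteq> ?D"
    by (auto simp: sphere_set_eq)
  have S_eq: "{b \<in> ?D. enorm n b = 1} = ?S"
    by (simp add: sphere_set_eq)
  obtain K where K: "continuous_map (prod_topology (top_of_set ?I) (prod_topology (disc n) X)) X K"
    and K0: "\<And>z. K (0, z) = L z" and K1: "\<And>z. K (1, z) = snd z"
    using L by (auto simp: homotopic_with_def)
  have K_compose: "continuous_map (top_of_set T) X (\<lambda>z. K (a z, (b z, c z)))"
    if "continuous_on T a" "a \<in> T \<rightarrow> ?I" "continuous_on T b" "b \<in> T \<rightarrow> ?D" "continuous_map (top_of_set T) X c"
    for T :: "'t::topological_space set" and a b c
  proof -
    have "continuous_map (top_of_set T) (prod_topology (top_of_set ?I) (prod_topology (disc n) X))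
        (\<lambda>z. (a z, (b z, c z)))"
      using that by (intro continuous_map_pairedI)
        (auto simp: disc_eq continuous_map_in_subtopology)
    from continuous_map_compose[OF this K] show ?thesis
      by (simp add: o_def)
  qed

  \<comment> \<open>A path from y s at time -1 through L(s, y s) at time 0 to e at time 1: the
    homotopy K run backwards, followed by h.\<close>
  define P where "P z = (if snd z \<le> 0 then K (- snd z, (fst z, y (fst z))) else h z)" for z
  have P: "continuous_map (top_of_set (?S \<times> {-1..1})) X P"
    unfolding P_def
  proof (rule continuous_map_cases_le_on)
    show "continuous_map (top_of_set {z \<in> ?S \<times> {-1..1}. snd z \<le> 0}) X
        (\<lambda>z. K (- snd z, (fst z, y (fst z))))"
      by (intro K_compose continuous_map_compose_on[OF y] continuous_intros) (use SD in auto)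
    show "continuous_map (top_of_set {z \<in> ?S \<times> {-1..1}. 0 \<le> snd z}) X h"
      by (rule continuous_map_from_subtopology_mono[OF h]) auto
  qed (auto intro!: continuous_intros simp: K0 h0)
  have P_neg: "P (s, - t) = K (t, (s, y s))" if "0 \<le> t" for s t
    using that by (simp add: P_def)
  have P_pos: "P (s, t) = h (s, t)" if "s \<in> ?S" "0 \<le> t" for s t
    using that h0[of s] by (auto simp: P_def K0)

  \<comment> \<open>Over the boundary, g runs backwards along P from e to y s. It starts from the
    constant map e on the disc, and its far end is the extension of y.\<close>
  obtain g where g: "continuous_map (top_of_set (?D \<times> ?I)) X g"
    and g0: "\<And>d. d \<in> ?D \<Longrightarrow> g (d, 0) = e"
    and gS: "\<And>d u. d \<in> ?D \<Longrightarrow> enorm n d = 1 \<Longrightarrow> u \<in> ?I \<Longrightarrow> g (d, u) = P (d, 1 - 2 * u)"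
  proof (rule gauge_homotopy_extension[of ?D "enorm n" escale X "\<lambda>_. e" "\<lambda>z. P (fst z, 1 - 2 * snd z)"])
    show "continuous_map (top_of_set ({b \<in> ?D. enorm n b = 1} \<times> ?I)) X (\<lambda>z. P (fst z, 1 - 2 * snd z))"
      unfolding S_eq
      by (intro continuous_map_compose_on[OF P] continuous_intros) auto
    show "P (fst (b, 0), 1 - 2 * snd (b, 0)) = e" if "b \<in> ?D" "enorm n b = 1" for b
      using that h1[of b] P_pos[of b 1] by (simp add: sphere_set_eq)
    show "continuous_on (UNIV \<times> ?D) (\<lambda>(c, b). escale c b)"
      unfolding case_prod_unfold by (intro continuous_intros)
    show "enorm n b \<le> 1" if "b \<in> ?D" for b
      using that by (simp add: disc_set_eq)
  qed (use e in \<open>auto intro!: continuous_intros simp: enorm_escale escale_mem_disc_set\<close>)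
  define y' where "y' d = g (d, 1)" for d
  have y': "continuous_map (top_of_set ?D) X y'"
    unfolding y'_def by (intro continuous_map_compose_on[OF g] continuous_intros) auto
  have y'_S: "y' s = y s" if "s \<in> ?S" for s
    using that gS[of s 1] P_neg[of 1 s] by (simp add: y'_def sphere_set_eq K1)

  \<comment> \<open>A first candidate for h': along K from L(d, y' d) to y' d, then back along g to
    e.\<close>
  define k where "k z = (if snd z \<le> 1/2 then K (2 * snd z, (fst z, y' (fst z)))
      else g (fst z, 2 - 2 * snd z))" for z
  have k: "continuous_map (top_of_set (?D \<times> ?I)) X k"
    unfolding k_def
  proof (rule continuous_map_cases_le_on)
    show "continuous_map (top_of_set {z \<in> ?D \<times> ?I. snd z \<le> 1/2}) X
        (\<lambda>z. K (2 * snd z, (fst z, y' (fst z))))"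
      by (intro K_compose continuous_map_compose_on[OF y'] continuous_intros) auto
    show "continuous_map (top_of_set {z \<in> ?D \<times> ?I. 1/2 \<le> snd z}) X (\<lambda>z. g (fst z, 2 - 2 * snd z))"
      by (intro continuous_map_compose_on[OF g] continuous_intros) auto
    show "K (2 * snd z, (fst z, y' (fst z))) = g (fst z, 2 - 2 * snd z)" if "snd z = 1/2" for z
      unfolding that by (simp add: K1 y'_def)
  qed (intro continuous_intros)+
  have k0: "k (d, 0) = L (d, y' d)" for d
    by (simp add: k_def K0)
  have k1: "k (d, 1) = e" if "d \<in> ?D" for d
    using that by (simp add: k_def g0)
  define \<beta> :: "real \<Rightarrow> real" where "\<beta> t = max (- (2 * t)) (4 * t - 3)" for t
  have \<beta>: "\<beta> 0 = 0" "\<beta> 1 = 1" "-1 \<le> \<beta> t" "t \<in> ?I \<Longrightarrow> \<beta> t \<le> 1" for t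
    by (auto simp: \<beta>_def max_def)
  have k_S: "k (s, t) = P (s, \<beta> t)" if "s \<in> ?S" "t \<in> ?I" for s t
  proof (cases "t \<le> 1/2")
    case True
    then have "\<beta> t = - (2 * t)" by (simp add: \<beta>_def)
    with that True P_neg[of "2 * t" s] y'_S show ?thesis by (simp add: k_def)
  next
    case False
    then have "\<beta> t = 1 - 2 * (2 - 2 * t)" by (simp add: \<beta>_def)
    with that False gS[of s "2 - 2 * t"] show ?thesis by (simp add: k_def sphere_set_eq)
  qed

  \<comment> \<open>The unit ball of this gauge is the cylinder over the disc, centred at (0, 1/2).
    Homotopy extension thus applies relative to the full boundary of the cylinder, both ends
    included.\<close>
  define N where "N z = max (enorm n (fst z)) \<bar>2 * snd z - 1\<bar>" for z :: "(nat \<Rightarrow> real) \<times> real"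
  define sc where "sc c z = (escale c (fst z), 1/2 + c * (snd z - 1/2))" for c and z :: "(nat \<Rightarrow> real) \<times> real"
  \<comment> \<open>On the lateral side time moves linearly from \<beta> t to t, which removes the
    detour through negative times and leaves h; on the two ends k is kept. The cases agree at the
    rims because \<beta> fixes 0 and 1.\<close>
  define H where "H w = (if \<bar>2 * snd (fst w) - 1\<bar> \<le> enorm n (fst (fst w))
      then P (fst (fst w), (1 - snd w) * \<beta> (snd (fst w)) + snd w * snd (fst w)) else k (fst w))" for w
  let ?B = "?D \<times> ?I"
  have comb: "(1 - u) * \<beta> t + u * t \<in> {-1..1}" if "t \<in> ?I" "u \<in> ?I" for t u
  proof -
    have "convex {-1..1::real}" by simp
    from convexD_alt[OF this, of "\<beta> t" t u] show ?thesis
      using that \<beta>(3,4)[of t] by simp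
  qed
  have end_eq: "P (s, (1 - u) * \<beta> t + u * t) = k (s, t)" if "s \<in> ?S" "\<bar>2 * t - 1\<bar> = 1" for s t u
  proof -
    have "t = 0 \<or> t = 1" using that(2) by linarith
    then show ?thesis using that(1) k_S[of s t] \<beta>(1,2) by auto
  qed
  have H: "continuous_map (top_of_set ({b \<in> ?B. N b = 1} \<times> ?I)) X H"
    unfolding H_def
  proof (rule continuous_map_cases_le_on)
    let ?T = "{b \<in> ?B. N b = 1} \<times> ?I"
    show "continuous_map (top_of_set {w \<in> ?T. \<bar>2 * snd (fst w) - 1\<bar> \<le> enorm n (fst (fst w))}) X
        (\<lambda>w. P (fst (fst w), (1 - snd w) * \<beta> (snd (fst w)) + snd w * snd (fst w)))"
    proof (rule continuous_map_compose_on[OF P])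
      show "(\<lambda>w. (fst (fst w), (1 - snd w) * \<beta> (snd (fst w)) + snd w * snd (fst w)))
          \<in> {w \<in> ?T. \<bar>2 * snd (fst w) - 1\<bar> \<le> enorm n (fst (fst w))} \<rightarrow> ?S \<times> {-1..1}"
        using comb by (force simp: sphere_set_eq N_def)
    qed (unfold \<beta>_def, intro continuous_intros)
    show "continuous_map (top_of_set {w \<in> ?T. enorm n (fst (fst w)) \<le> \<bar>2 * snd (fst w) - 1\<bar>}) X (\<lambda>w. k (fst w))"
      by (intro continuous_map_compose_on[OF k] continuous_intros) auto
    show "P (fst (fst w), (1 - snd w) * \<beta> (snd (fst w)) + snd w * snd (fst w)) = k (fst w)"
      if "w \<in> ?T" "\<bar>2 * snd (fst w) - 1\<bar> = enorm n (fst (fst w))" for w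
      using that end_eq[of "fst (fst w)" "snd (fst w)" "snd w"] by (auto simp: N_def sphere_set_eq)
  qed (intro continuous_intros)+
  obtain G where G: "continuous_map (top_of_set (?B \<times> ?I)) X G"
    and GS: "\<And>b u. b \<in> ?B \<Longrightarrow> N b = 1 \<Longrightarrow> u \<in> ?I \<Longrightarrow> G (b, u) = H (b, u)"
  proof (rule gauge_homotopy_extension[OF _ _ _ _ _ k H])
    show "continuous_on ?B N"
      unfolding N_def by (intro continuous_intros)
    show "continuous_on (UNIV \<times> ?B) (\<lambda>(c, b). sc c b)"
      unfolding case_prod_unfold sc_def by (intro continuous_intros)
    show "sc 1 b = b" for b
      by (simp add: sc_def)
    show "N b \<le> 1" if "b \<in> ?B" for b
      using that by (auto simp: N_def disc_set_eq abs_le_iff)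
    show "sc c b \<in> ?B \<and> N (sc c b) = c * N b" if "b \<in> ?B" "0 \<le> c" "c * N b \<le> 1" for c b
    proof -
      have "2 * (1/2 + c * (snd b - 1/2)) - 1 = c * (2 * snd b - 1)"
        by (simp add: algebra_simps)
      from arg_cong[OF this, of abs]
      have eq: "\<bar>2 * (1/2 + c * (snd b - 1/2)) - 1\<bar> = c * \<bar>2 * snd b - 1\<bar>"
        unfolding abs_mult using \<open>0 \<le> c\<close> by (simp only: abs_of_nonneg)
      have le: "c * enorm n (fst b) \<le> 1" "c * \<bar>2 * snd b - 1\<bar> \<le> 1"
        using that by (auto simp: N_def max_mult_distrib_left)
      have "N (sc c b) = c * N b"
        using \<open>0 \<le> c\<close> eq by (simp add: N_def sc_def enorm_escale max_mult_distrib_left)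
      moreover have "escale c (fst b) \<in> ?D"
        using that le by (intro escale_mem_disc_set) auto
      moreover have "1/2 + c * (snd b - 1/2) \<in> ?I"
        using le(2) eq by (auto simp: abs_le_iff)
      ultimately show ?thesis
        by (simp add: sc_def)
    qed
    show "H (b, 0) = k b" if "b \<in> ?B" "N b = 1" for b
      using that k_S[of "fst b" "snd b"] by (auto simp: H_def N_def sphere_set_eq)
  qed blast
  define h' where "h' z = G (z, 1)" for z
  have h'_bd: "h' z = H (z, 1)" if "z \<in> ?B" "N z = 1" for z
    using GS[OF that, of 1] by (simp add: h'_def)
  have h'_end: "h' (d, t) = k (d, t)" if "d \<in> ?D" "t = 0 \<or> t = 1" for d t
  proof -
    have "\<bar>2 * t - 1\<bar> = 1" "t \<in> ?I" using that(2) by auto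
    then have "N (d, t) = 1" "(d, t) \<in> ?B"
      using that(1) by (auto simp: N_def disc_set_eq)
    from h'_bd[OF this(2,1)] show ?thesis
      using end_eq[of d t 1] that \<open>\<bar>2 * t - 1\<bar> = 1\<close> \<open>(d, t) \<in> ?B\<close>
      by (auto simp: H_def sphere_set_eq disc_set_eq)
  qed
  show thesis
  proof
    show "continuous_map (top_of_set ?D) X y'" by (fact y')
    show "continuous_map (top_of_set ?B) X h'"
      unfolding h'_def by (intro continuous_map_compose_on[OF G] continuous_intros) auto
    show "h' (s, t) = h (s, t)" if "s \<in> ?S" "t \<in> ?I" for s t
    proof -
      have "enorm n s = 1" "s \<in> ?D" "\<bar>2 * t - 1\<bar> \<le> 1"
        using that by (auto simp: sphere_set_eq)
      then show ?thesis
        using that P_pos[of s t] by (subst h'_bd) (auto simp: N_def H_def)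
    qed
    show "h' (d, 0) = L (d, y' d)" if "d \<in> ?D" for d
      using that h'_end[of d 0] k0 by simp
    show "h' (d, 1) = e" if "d \<in> ?D" for d
      using that h'_end[of d 1] k1 by simp
  qed (fact y'_S)
qed

text \<open>A point y with a path from \<mu>(x, y) to e is a point of the homotopy fibre of \<mu>(x,
  -) over e; choosing one continuously in x amounts to an inverse together with its
  homotopy.\<close>

lemma (in cw_structure) homotopy_inverse:
  assumes pc: "path_connected_space X" and e: "e \<in> topspace X"
    and \<mu>: "continuous_map (prod_topology X X) X \<mu>"
    and unit: "homotopic_with (\<lambda>_. True) X X (\<lambda>x. \<mu> (e, x)) id"
  obtains \<iota> where "continuous_map X X \<iota>"
    "homotopic_with (\<lambda>_. True) X X (\<lambda>x. \<mu> (x, \<iota> x)) (\<lambda>_. e)"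
proof -
  let ?I = "top_of_set {0..1::real}"
  \<comment> \<open>The point y is stored as a first component that is constant in t, the path as
    the second component.\<close>
  define R where "R x g \<longleftrightarrow> (\<forall>t\<in>{0..1}. fst (g t) = fst (g 0)) \<and>
      snd (g 0) = \<mu> (x, fst (g 0)) \<and> snd (g 1) = e" for x and g :: "real \<Rightarrow> 'a \<times> 'a"
  obtain k where k: "continuous_map (prod_topology X ?I) (prod_topology X X) k"
    and kR: "\<And>x. x \<in> topspace X \<Longrightarrow> R x (\<lambda>t. k (x, t))"
  proof (rule cellwise_extension[of ?I R "prod_topology X X"])
    show "compact_space ?I" "Hausdorff_space ?I"
      by (auto simp: compact_space_subtopology Hausdorff_space_subtopology)
    show "R x g'" if "\<And>t. t \<in> topspace ?I \<Longrightarrow> g t = g' t" "R x g" for x g g'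
    proof -
      have "g 0 = g' 0" "g 1 = g' 1" "\<And>t. t \<in> {0..1} \<Longrightarrow> g t = g' t"
        using that(1) by auto
      then show ?thesis using that(2) unfolding R_def by metis
    qed
    fix n \<Phi> and k :: "(nat \<Rightarrow> real) \<times> real \<Rightarrow> 'a \<times> 'a"
    assume \<Phi>: "continuous_map (disc n) X \<Phi>"
      and k: "continuous_map (prod_topology (subtopology (disc n) (sphere_set n)) ?I) (prod_topology X X) k"
      and kR: "\<And>d. d \<in> sphere_set n \<Longrightarrow> R (\<Phi> d) (\<lambda>t. k (d, t))"
    let ?L = "\<lambda>z. \<mu> (\<Phi> (fst z), snd z)"
    have "disc_set n \<inter> sphere_set n = sphere_set n"
      by (auto simp: sphere_set_eq)
    with k have k: "continuous_map (top_of_set (sphere_set n \<times> {0..1})) (prod_topology X X) k"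
      by (simp add: disc_eq subtopology_subtopology)
    \<comment> \<open>Since the disc is contractible and X path connected, the characteristic map
      deforms to the constant e; the left unit does the rest.\<close>
    have L: "homotopic_with (\<lambda>_. True) (prod_topology (disc n) X) X ?L snd"
    proof (rule homotopic_with_trans)
      have "homotopic_with (\<lambda>_. True) (disc n) X \<Phi> (\<lambda>_. e)"
        using \<Phi> contractible_space_disc pc e by (intro homotopic_from_contractible_space) simp
      then have "homotopic_with (\<lambda>_. True) (prod_topology (disc n) X) (prod_topology X X)
          (\<lambda>z. (\<Phi> (fst z), id (snd z))) (\<lambda>z. (e, id (snd z)))"
        by (rule homotopic_with_prod_topology) auto
      from homotopic_with_compose_continuous_map_left[OF this \<mu>]
      show "homotopic_with (\<lambda>_. True) (prod_topology (disc n) X) X ?L (\<lambda>z. \<mu> (e, snd z))"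
        by (simp add: o_def)
      from homotopic_with_compose_continuous_map_right[OF unit continuous_map_snd, of "\<lambda>_. True" "disc n"]
      show "homotopic_with (\<lambda>_. True) (prod_topology (disc n) X) X (\<lambda>z. \<mu> (e, snd z)) snd"
        by (simp add: o_def)
    qed
    have kf: "continuous_map (top_of_set (sphere_set n \<times> {0..1})) X (\<lambda>z. fst (k z))"
      and ks: "continuous_map (top_of_set (sphere_set n \<times> {0..1})) X (\<lambda>z. snd (k z))"
      using k by (simp_all add: continuous_map_pairwise o_def)
    obtain y h where y: "continuous_map (top_of_set (disc_set n)) X y"
      and h: "continuous_map (top_of_set (disc_set n \<times> {0..1})) X h"
      and yS: "\<And>s. s \<in> sphere_set n \<Longrightarrow> y s = fst (k (s, 0))"
      and hS: "\<And>s t. s \<in> sphere_set n \<Longrightarrow> t \<in> {0..1} \<Longrightarrow> h (s, t) = snd (k (s, t))"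
      and h0: "\<And>d. d \<in> disc_set n \<Longrightarrow> h (d, 0) = ?L (d, y d)"
      and h1: "\<And>d. d \<in> disc_set n \<Longrightarrow> h (d, 1) = e"
    proof (rule disc_section_extension[OF L e, of "\<lambda>s. fst (k (s, 0))" "\<lambda>z. snd (k z)"])
      show "continuous_map (top_of_set (sphere_set n)) X (\<lambda>s. fst (k (s, 0)))"
        by (intro continuous_map_compose_on[OF kf] continuous_intros) auto
      show "snd (k (s, 0)) = \<mu> (\<Phi> (fst (s, fst (k (s, 0)))), snd (s, fst (k (s, 0))))"
        "snd (k (s, 1)) = e" if "s \<in> sphere_set n" for s
        using kR[OF that] by (simp_all only: R_def fst_conv snd_conv)
      show "continuous_map (top_of_set (sphere_set n \<times> {0..1})) X (\<lambda>z. snd (k z))"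
        by (fact ks)
    qed blast
    have "continuous_map (top_of_set (disc_set n \<times> {0..1})) (prod_topology X X) (\<lambda>z. (y (fst z), h z))"
      by (intro continuous_map_pairedI h continuous_map_compose_on[OF y] continuous_intros) auto
    moreover have "(y (fst (d, t)), h (d, t)) = k (d, t)" if "d \<in> sphere_set n" "t \<in> topspace ?I" for d t
    proof -
      have "fst (k (d, t)) = fst (k (d, 0))"
        using kR[OF that(1)] that(2) unfolding R_def topspace_euclidean_subtopology by blast
      then show ?thesis
        using that yS[of d] hS[of d t] by (simp add: prod_eq_iff)
    qed
    moreover have "R (\<Phi> d) (\<lambda>t. (y (fst (d, t)), h (d, t)))" if "d \<in> disc_set n" for d
      using that h0 h1 by (simp add: R_def)
    ultimately show "\<exists>k'. continuous_map (prod_topology (disc n) ?I) (prod_topology X X) k' \<and>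
        (\<forall>d\<in>sphere_set n. \<forall>t\<in>topspace ?I. k' (d, t) = k (d, t)) \<and>
        (\<forall>d\<in>disc_set n. R (\<Phi> d) (\<lambda>t. k' (d, t)))"
      by (intro exI[of _ "\<lambda>z. (y (fst z), h z)"]) (simp add: disc_eq)
  qed blast
  show thesis
  proof
    have c0: "continuous_map X (prod_topology X ?I) (\<lambda>x. (x, 0))"
      by (intro continuous_map_pairedI) auto
    show "continuous_map X X (\<lambda>x. fst (k (x, 0)))"
      using continuous_map_compose[OF c0 k] by (simp add: continuous_map_pairwise o_def)
    have sw: "continuous_map (prod_topology ?I X) (prod_topology X ?I) (\<lambda>z. (snd z, fst z))"
      by (intro continuous_map_pairedI continuous_map_snd continuous_map_fst)
    have "continuous_map (prod_topology ?I X) X (\<lambda>z. snd (k (snd z, fst z)))"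
      using continuous_map_compose[OF sw k] by (simp add: continuous_map_pairwise o_def)
    moreover have "snd (k (x, 0)) = \<mu> (x, fst (k (x, 0)))" "snd (k (x, 1)) = e" if "x \<in> topspace X" for x
      using kR[OF that] unfolding R_def by blast+
    ultimately show "homotopic_with (\<lambda>_. True) X X (\<lambda>x. \<mu> (x, fst (k (x, 0)))) (\<lambda>_. e)"
      by (subst homotopic_with) (auto intro!: exI[of _ "\<lambda>z. snd (k (snd z, fst z))"])
  qed
qed

section \<open>Coverings and path lifting\<close>

lemma connected_space_top_of_set: "connected S \<Longrightarrow> connected_space (top_of_set S)"
  by (simp add: connectedin_def flip: connectedin_iff_connected)

locale covering =
  fixes E :: "'b topology" and B :: "'a topology" and p :: "'b \<Rightarrow> 'a"
  assumes covering_map: "covering_map E B p"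
begin

lemma continuous_p: "continuous_map E B p"
  using covering_map by (simp add: covering_map_def)

lemma fibre_nonempty: "x \<in> topspace B \<Longrightarrow> \<exists>y\<in>topspace E. p y = x"
  using covering_map unfolding covering_map_def by (metis imageE)

text \<open>Each sheet is presented by a local section inverse to p, because lifts are obtained by
  composing with such sections.\<close>

definition evenly_covered :: "'a set \<Rightarrow> 'b set set \<Rightarrow> bool" where
  "evenly_covered U V \<longleftrightarrow> openin B U \<and> (\<forall>y\<in>topspace E. p y \<in> U \<longrightarrow> y \<in> \<Union>V) \<and>
     pairwise disjnt V \<and>
     (\<forall>W\<in>V. openin E W \<and> inj_on p W \<and>
        (\<exists>q. continuous_map (subtopology B U) E q \<and> (\<forall>x\<in>U. q x \<in> W \<and> p (q x) = x)))"

lemma evenly_covered_neighbourhood: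
  assumes "x \<in> topspace B"
  obtains U V where "evenly_covered U V" "x \<in> U"
proof -
  obtain U V where U: "x \<in> U" "openin B U" and V: "\<Union>V = {y \<in> topspace E. p y \<in> U}"
      "\<forall>W\<in>V. openin E W" "pairwise disjnt V"
      "\<forall>W\<in>V. homeomorphic_map (subtopology E W) (subtopology B U) p"
    using covering_map assms unfolding covering_map_def by meson
  have "inj_on p W \<and> (\<exists>q. continuous_map (subtopology B U) E q \<and> (\<forall>x\<in>U. q x \<in> W \<and> p (q x) = x))"
    if W: "W \<in> V" for W
  proof -
    have top: "topspace (subtopology E W) = W" "topspace (subtopology B U) = U"
      using V(2) W U(2) openin_subset by (auto simp: topspace_subtopology_subset)
    have hom: "homeomorphic_map (subtopology E W) (subtopology B U) p"
      using V(4) W by blast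
    then obtain q where q: "homeomorphic_maps (subtopology E W) (subtopology B U) p q"
      by (auto simp: homeomorphic_map_maps)
    then have "continuous_map (subtopology B U) (subtopology E W) q" "\<forall>x\<in>U. p (q x) = x"
      unfolding homeomorphic_maps_def top by auto
    then have "continuous_map (subtopology B U) E q" "\<forall>x\<in>U. q x \<in> W \<and> p (q x) = x"
      using top by (auto simp: continuous_map_in_subtopology)
    with homeomorphic_imp_injective_map[OF hom] top show ?thesis
      by auto
  qed
  with U V have "evenly_covered U V"
    by (auto simp: evenly_covered_def)
  with that U show thesis by blast
qed

lemma lifts_agree:
  assumes T: "connected_space T"
    and f: "continuous_map T E f" and g: "continuous_map T E g"
    and pfg: "\<And>z. z \<in> topspace T \<Longrightarrow> p (f z) = p (g z)"
    and z0: "z0 \<in> topspace T" "f z0 = g z0" and z: "z \<in> topspace T"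
  shows "f z = g z"
proof -
  let ?A = "{z \<in> topspace T. f z = g z}"
  \<comment> \<open>Near z both maps stay in fixed sheets: in a common sheet injectivity of p makes
    them equal, in different sheets they differ. So the set of agreement is open and closed.\<close>
  have local: "\<exists>N. openin T N \<and> z \<in> N \<and> (\<forall>w\<in>N. f w = g w \<longleftrightarrow> f z = g z)" if z: "z \<in> topspace T" for z
  proof -
    have fz: "f z \<in> topspace E" "g z \<in> topspace E"
      using z f g by (auto simp: continuous_map_def)
    then have "p (f z) \<in> topspace B"
      using continuous_p by (auto simp: continuous_map_def)
    then obtain U V where UV: "evenly_covered U V" "p (f z) \<in> U"
      by (rule evenly_covered_neighbourhood)
    obtain W1 W2 where W: "W1 \<in> V" "f z \<in> W1" "W2 \<in> V" "g z \<in> W2"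
      using UV fz pfg[OF z] unfolding evenly_covered_def by (metis Union_iff)
    have op: "openin E W1" "openin E W2" "inj_on p W1" "pairwise disjnt V"
      using UV W by (auto simp: evenly_covered_def)
    let ?N = "{w \<in> topspace T. f w \<in> W1} \<inter> {w \<in> topspace T. g w \<in> W2}"
    have "openin T ?N"
      by (intro openin_Int openin_continuous_map_preimage[OF f] openin_continuous_map_preimage[OF g] op)
    moreover have "f w = g w \<longleftrightarrow> f z = g z" if "w \<in> ?N" for w
    proof (cases "W1 = W2")
      case True
      then have "f w = g w" "f z = g z"
        using that W op(3) pfg z by (auto intro: inj_onD)
      then show ?thesis by simp
    next
      case False
      then have "disjnt W1 W2"
        using op(4) W by (auto simp: pairwise_def)
      then show ?thesis
        using that W by (auto simp: disjnt_iff)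
    qed
    moreover have "z \<in> ?N"
      using z W by auto
    ultimately show ?thesis by blast
  qed
  have "openin T ?A"
  proof (subst openin_subopen, intro ballI)
    fix z assume z: "z \<in> ?A"
    then obtain N where N: "openin T N" "z \<in> N" "\<forall>w\<in>N. f w = g w \<longleftrightarrow> f z = g z"
      using local by blast
    then show "\<exists>N. openin T N \<and> z \<in> N \<and> N \<subseteq> ?A"
      using z openin_subset[OF N(1)] by blast
  qed
  moreover have "openin T (topspace T - ?A)"
  proof (subst openin_subopen, intro ballI)
    fix z assume z: "z \<in> topspace T - ?A"
    then obtain N where N: "openin T N" "z \<in> N" "\<forall>w\<in>N. f w = g w \<longleftrightarrow> f z = g z"
      using local by blast
    then show "\<exists>N. openin T N \<and> z \<in> N \<and> N \<subseteq> topspace T - ?A"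
      using z openin_subset[OF N(1)] by blast
  qed
  then have "closedin T ?A"
    by (simp add: closedin_def)
  ultimately have "?A = {} \<or> ?A = topspace T"
    using T unfolding connected_space_clopen_in by blast
  with z0 z show ?thesis by auto
qed

text \<open>The lift may be prescribed at any point of S; gluing relies on this, as the second lift
  is started in the overlap.\<close>

definition liftable :: "('c::topological_space \<Rightarrow> 'a) \<Rightarrow> 'c set \<Rightarrow> bool" where
  "liftable G S \<longleftrightarrow> (\<forall>z\<in>S. \<forall>y\<in>topspace E. p y = G z \<longrightarrow>
     (\<exists>g. continuous_map (top_of_set S) E g \<and> g z = y \<and> (\<forall>w\<in>S. p (g w) = G w)))"

lemma liftable_evenly_covered:
  assumes G: "continuous_map (top_of_set S) B G" and U: "evenly_covered U V" and GU: "G ` S \<subseteq> U"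
  shows "liftable G S"
  unfolding liftable_def
proof (intro ballI impI)
  fix z y assume z: "z \<in> S" "y \<in> topspace E" "p y = G z"
  then have "p y \<in> U" using GU by auto
  then obtain W where W: "W \<in> V" "y \<in> W"
    using U z by (auto simp: evenly_covered_def)
  then obtain q where q: "continuous_map (subtopology B U) E q" "\<forall>x\<in>U. q x \<in> W \<and> p (q x) = x"
    and inj: "inj_on p W"
    using U by (auto simp: evenly_covered_def)
  have "continuous_map (top_of_set S) (subtopology B U) G"
    using G GU by (auto simp: continuous_map_in_subtopology)
  from continuous_map_compose[OF this q(1)]
  have "continuous_map (top_of_set S) E (q \<circ> G)" .
  moreover have "(q \<circ> G) z = y"
    using q(2) W z \<open>p y \<in> U\<close> inj by (auto intro: inj_onD)
  moreover have "\<forall>w\<in>S. p ((q \<circ> G) w) = G w"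
    using q(2) GU by auto
  ultimately show "\<exists>g. continuous_map (top_of_set S) E g \<and> g z = y \<and> (\<forall>w\<in>S. p (g w) = G w)"
    by blast
qed

text \<open>A lift on one piece gives a value at a point of the overlap, from which the other piece
  is lifted; connectedness of the overlap forces the two lifts to agree there.\<close>

lemma liftable_Un:
  assumes S: "closed S" "closed T" "connected (S \<inter> T)" "S \<inter> T \<noteq> {}"
    and lift: "liftable G S" "liftable G T"
  shows "liftable G (S \<union> T)"
proof -
  \<comment> \<open>Stated for its own S and T, because the prescribed point may lie in either
    piece.\<close>
  have main: "\<exists>g. continuous_map (top_of_set (S \<union> T)) E g \<and> g z = y \<and> (\<forall>w\<in>S \<union> T. p (g w) = G w)"
    if S: "closed S" "closed T" "connected (S \<inter> T)" "S \<inter> T \<noteq> {}"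
      and lift: "liftable G S" "liftable G T"
      and z: "z \<in> S" "y \<in> topspace E" "p y = G z" for S T z y
  proof -
    obtain g where g: "continuous_map (top_of_set S) E g" "g z = y" "\<forall>w\<in>S. p (g w) = G w"
      using lift(1) z by (auto simp: liftable_def)
    obtain w where w: "w \<in> S" "w \<in> T" using S by auto
    then have "g w \<in> topspace E"
      using g(1) by (auto simp: continuous_map_def)
    then obtain h where h: "continuous_map (top_of_set T) E h" "h w = g w" "\<forall>w\<in>T. p (h w) = G w"
      using lift(2) w g(3) unfolding liftable_def by metis
    have agree: "g x = h x" if "x \<in> S \<inter> T" for x
    proof (rule lifts_agree[of "top_of_set (S \<inter> T)" g h w])
      show "connected_space (top_of_set (S \<inter> T))"
        using S(3) by (rule connected_space_top_of_set)
      show "continuous_map (top_of_set (S \<inter> T)) E g" "continuous_map (top_of_set (S \<inter> T)) E h"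
        using g(1) h(1) by (auto elim: continuous_map_from_subtopology_mono)
    qed (use g h w that in auto)
    have "continuous_map (top_of_set (S \<union> T)) E (\<lambda>x. if x \<in> S then g x else h x)"
    proof (rule pasting_lemma_closed[of "{True, False}" "top_of_set (S \<union> T)"
          "\<lambda>b. if b then S else T" E "\<lambda>b. if b then g else h"])
      show "closedin (top_of_set (S \<union> T)) (if i then S else T)" if "i \<in> {True, False}" for i
        using S by (auto intro: closed_subset)
      show "continuous_map (subtopology (top_of_set (S \<union> T)) (if i then S else T)) E (if i then g else h)"
        if "i \<in> {True, False}" for i
        using g(1) h(1) by (simp add: subtopology_subtopology Int_absorb1)
    qed (use agree in auto)
    moreover have "\<forall>w\<in>S \<union> T. p (if w \<in> S then g w else h w) = G w"
      using g(3) h(3) by auto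
    ultimately show ?thesis
      using g(2) z(1) by (intro exI[of _ "\<lambda>x. if x \<in> S then g x else h x"]) auto
  qed
  show ?thesis
    unfolding liftable_def
  proof (intro ballI impI)
    fix z y assume z: "z \<in> S \<union> T" "y \<in> topspace E" "p y = G z"
    show "\<exists>g. continuous_map (top_of_set (S \<union> T)) E g \<and> g z = y \<and> (\<forall>w\<in>S \<union> T. p (g w) = G w)"
    proof (cases "z \<in> S")
      case True
      with main[OF S lift] z show ?thesis by blast
    next
      case False
      with main[of T S z y] S lift z show ?thesis
        by (simp add: Un_commute Int_commute)
    qed
  qed
qed

text \<open>A Lebesgue number provides a grid whose squares map into evenly covered sets. Squares
  are glued to rows and rows are stacked, so that every overlap is a segment and hence
  connected.\<close>

lemma liftable_square:
  fixes G :: "real \<times> real \<Rightarrow> 'a"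
  assumes G: "continuous_map (top_of_set ({0..1} \<times> {0..1})) B G"
  shows "liftable G ({0..1} \<times> {0..1})"
proof -
  let ?Q = "{0..1::real} \<times> {0..1::real}"
  define \<C> where "\<C> = {T. open T \<and> (\<exists>U V. evenly_covered U V \<and> G ` (?Q \<inter> T) \<subseteq> U)}"
  have "\<exists>T\<in>\<C>. z \<in> T" if z: "z \<in> ?Q" for z
  proof -
    have "G z \<in> topspace B"
      using G z by (auto simp: continuous_map_def)
    then obtain U V where U: "evenly_covered U V" "G z \<in> U"
      by (rule evenly_covered_neighbourhood)
    then have "openin (top_of_set ?Q) {w \<in> topspace (top_of_set ?Q). G w \<in> U}"
      using G by (intro openin_continuous_map_preimage) (auto simp: evenly_covered_def)
    then obtain T where T: "open T" "{w \<in> ?Q. G w \<in> U} = ?Q \<inter> T"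
      by (auto simp: openin_open)
    then have "G ` (?Q \<inter> T) \<subseteq> U" by auto
    with T U have "T \<in> \<C>" by (auto simp: \<C>_def)
    with T U z show ?thesis by blast
  qed
  then have "?Q \<subseteq> \<Union>\<C>" by blast
  moreover have "compact ?Q"
    by (intro compact_Times) auto
  moreover have "open T" if "T \<in> \<C>" for T
    using that by (simp add: \<C>_def)
  ultimately obtain \<epsilon> where \<epsilon>: "\<epsilon> > 0" "\<And>z. z \<in> ?Q \<Longrightarrow> \<exists>T\<in>\<C>. ball z \<epsilon> \<subseteq> T"
    using Heine_Borel_lemma[of ?Q \<C>] by metis
  \<comment> \<open>Sides shorter than \<epsilon>/2 keep a grid square within distance \<epsilon> of
    its lower left corner, as the Euclidean distance is at most the sum of the coordinate
    distances.\<close>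
  obtain n where n: "inverse (real (Suc n)) < \<epsilon> / 2"
    using reals_Archimedean[of "\<epsilon> / 2"] \<epsilon>(1) by auto
  define r where "r i = real i / real (Suc n)" for i
  have r: "r 0 = 0" "r (Suc n) = 1" "\<And>i. 0 \<le> r i" "\<And>i. r i \<le> r (Suc i)"
      "\<And>i. r (Suc i) - r i < \<epsilon> / 2" "\<And>i. i \<le> Suc n \<Longrightarrow> r i \<le> 1"
    using n by (auto simp: r_def field_simps)
  have small: "liftable G S" if S: "S \<subseteq> ?Q" "S \<subseteq> {r i..r (Suc i)} \<times> {r j..r (Suc j)}"
    "i \<le> n" "j \<le> n" for S i j
  proof -
    have "(r i, r j) \<in> ?Q"
      using S r by auto
    then obtain T where T: "T \<in> \<C>" "ball (r i, r j) \<epsilon> \<subseteq> T"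
      using \<epsilon>(2) by blast
    have "S \<subseteq> ball (r i, r j) \<epsilon>"
    proof
      fix z assume "z \<in> S"
      then have z: "r i \<le> fst z" "fst z \<le> r (Suc i)" "r j \<le> snd z" "snd z \<le> r (Suc j)"
        using S by auto
      have "dist (r i, r j) z \<le> \<bar>r i - fst z\<bar> + \<bar>r j - snd z\<bar>"
        using sqrt_sum_squares_le_sum_abs[of "r i - fst z" "r j - snd z"]
        by (simp add: dist_prod_def dist_real_def)
      also have "\<dots> < \<epsilon>"
        using z r(5)[of i] r(5)[of j] by linarith
      finally show "z \<in> ball (r i, r j) \<epsilon>" by simp
    qed
    with S(1) T(2) have "S \<subseteq> ?Q \<inter> T" by blast
    moreover obtain U V where "evenly_covered U V" "G ` (?Q \<inter> T) \<subseteq> U"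
      using T(1) unfolding \<C>_def by blast
    ultimately have "evenly_covered U V" "G ` S \<subseteq> U" by blast+
    moreover have "continuous_map (top_of_set S) B G"
      using G S(1) by (rule continuous_map_from_subtopology_mono)
    ultimately show ?thesis
      using liftable_evenly_covered by blast
  qed
  have row: "liftable G ({0..r i} \<times> {r j..r (Suc j)})" if "i \<le> Suc n" "j \<le> n" for i j
    using that(1)
  proof (induction i)
    \<comment> \<open>As \<open>r 0 = 0\<close>, the row starts with its left edge, a segment inside
      the first small square.\<close>
    case 0
    have "{0..r 0} \<times> {r j..r (Suc j)} \<subseteq> ?Q" "{0..r 0} \<times> {r j..r (Suc j)} \<subseteq> {r 0..r (Suc 0)} \<times> {r j..r (Suc j)}"
      using r(3)[of j] r(6)[of "Suc j"] r(4)[of 0] that by (auto simp: r(1))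
    with small[of _ 0 j] that show ?case by blast
  next
    case (Suc i)
    have eq: "{0..r (Suc i)} \<times> {r j..r (Suc j)} =
        {0..r i} \<times> {r j..r (Suc j)} \<union> {r i..r (Suc i)} \<times> {r j..r (Suc j)}"
      using r(3)[of i] r(4)[of i] by auto
    have int: "{0..r i} \<times> {r j..r (Suc j)} \<inter> {r i..r (Suc i)} \<times> {r j..r (Suc j)}
        = {r i} \<times> {r j..r (Suc j)}"
      using r(3)[of i] r(4)[of i] by auto
    have "{r i..r (Suc i)} \<times> {r j..r (Suc j)} \<subseteq> ?Q"
      using r(3)[of j] r(3)[of i] r(6)[of "Suc j"] r(6)[of "Suc i"] Suc.prems that by auto
    then have "liftable G ({r i..r (Suc i)} \<times> {r j..r (Suc j)})"
      using small[of _ i j] Suc.prems that by simp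
    then show ?case
      unfolding eq using Suc r(4)[of j]
      by (intro liftable_Un) (auto simp: int intro!: closed_Times convex_connected convex_Times)
  qed
  have "liftable G ({0..1} \<times> {0..r (Suc j)})" if "j \<le> n" for j
    using that
  proof (induction j)
    case 0
    then show ?case
      using row[of "Suc n" 0] by (simp add: r)
  next
    case (Suc j)
    have eq: "{0..1} \<times> {0..r (Suc (Suc j))} =
        {0..1} \<times> {0..r (Suc j)} \<union> {0..1::real} \<times> {r (Suc j)..r (Suc (Suc j))}"
      using r(3)[of "Suc j"] r(4)[of "Suc j"] by auto
    have int: "{0..1} \<times> {0..r (Suc j)} \<inter> {0..1::real} \<times> {r (Suc j)..r (Suc (Suc j))} = {0..1} \<times> {r (Suc j)}"
      using r(3)[of "Suc j"] r(4)[of "Suc j"] by auto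
    have "liftable G ({0..1} \<times> {r (Suc j)..r (Suc (Suc j))})"
      using row[of "Suc n" "Suc j"] Suc.prems by (simp add: r)
    then show ?case
      unfolding eq using Suc
      by (intro liftable_Un) (auto simp: int intro!: closed_Times convex_connected convex_Times)
  qed
  from this[of n] show ?thesis
    by (simp add: r)
qed

end

section \<open>Concatenation and homotopy of paths\<close>

lemma pathin_pjoin:
  assumes "pathin X g" "pathin X h" "g 1 = h 0"
  shows "pathin X (pjoin g h)"
proof -
  have "continuous_map (top_of_set {0..1}) X (\<lambda>t. if t \<le> 1/2 then g (2 * t) else h (2 * t - 1))"
  proof (rule continuous_map_cases_le_on)
    show "continuous_map (top_of_set {t \<in> {0..1}. t \<le> 1/2}) X (\<lambda>t. g (2 * t))"
      by (rule continuous_map_compose_on[OF assms(1)[unfolded pathin_def]])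
        (auto intro!: continuous_intros)
    show "continuous_map (top_of_set {t \<in> {0..1}. 1/2 \<le> t}) X (\<lambda>t. h (2 * t - 1))"
      by (rule continuous_map_compose_on[OF assms(2)[unfolded pathin_def]])
        (auto intro!: continuous_intros)
    show "g (2 * t) = h (2 * t - 1)" if "t = 1/2" for t
      unfolding that using assms(3) by simp
  qed (intro continuous_intros)+
  then show ?thesis
    unfolding pathin_def pjoin_def .
qed

lemma pathin_prev:
  assumes "pathin X g"
  shows "pathin X (prev g)"
  using continuous_map_compose_on[OF assms[unfolded pathin_def], of "{0..1}" "\<lambda>t. 1 - t"]
  by (force simp: pathin_def prev_def[abs_def] intro: continuous_intros)

lemma pathin_square:
  assumes "continuous_map (top_of_set ({0..1::real} \<times> {0..1::real})) X G"
    and "continuous_on {0..1} a" "continuous_on {0..1} b"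
    and "a \<in> {0..1} \<rightarrow> {0..1}" "b \<in> {0..1} \<rightarrow> {0..1}"
  shows "pathin X (\<lambda>t. G (a t, b t))"
  unfolding pathin_def
  by (rule continuous_map_compose_on[OF assms(1)]) (use assms in \<open>auto intro!: continuous_intros\<close>)

lemma pjoin_ends: "pjoin g h 0 = g 0" "pjoin g h 1 = h 1"
  by (simp_all add: pjoin_def)

lemma prev_ends: "prev g 0 = g 1" "prev g 1 = g 0"
  by (simp_all add: prev_def)

text \<open>The homotopy parameter comes first and the path parameter second. Boundary conditions
  are asked on the unit interval only, so that explicit formulas need no adjustment outside
  it.\<close>

lemma path_homotopic_iff:
  "path_homotopic X a b \<longleftrightarrow> pathin X a \<and> pathin X b \<and>
     (\<exists>G. continuous_map (top_of_set ({0..1::real} \<times> {0..1::real})) X G \<and>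
        (\<forall>t\<in>{0..1}. G (0, t) = a t \<and> G (1, t) = b t \<and> G (t, 0) = a 0 \<and> G (t, 1) = a 1))"
  (is "?L \<longleftrightarrow> ?R")
proof
  assume L: ?L
  then obtain G where "continuous_map (prod_topology (top_of_set {0..1::real}) (top_of_set {0..1::real})) X G"
      "\<forall>x. G (0, x) = a x" "\<forall>x. G (1, x) = b x" "\<forall>t\<in>{0..1}. G (t, 0) = a 0 \<and> G (t, 1) = a 1"
    unfolding path_homotopic_def homotopic_with_def by blast
  with L show ?R
    unfolding path_homotopic_def by (intro conjI exI[of _ G]) auto
next
  assume R: ?R
  then obtain G where G: "continuous_map (top_of_set ({0..1::real} \<times> {0..1::real})) X G"
      "\<forall>t\<in>{0..1}. G (0, t) = a t" "\<forall>t\<in>{0..1}. G (1, t) = b t"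
      "\<forall>t\<in>{0..1}. G (t, 0) = a 0" "\<forall>t\<in>{0..1}. G (t, 1) = a 1"
    by blast
  have "homotopic_with (\<lambda>r. r 0 = a 0 \<and> r 1 = a 1) (top_of_set {0..1}) X a b"
    using G by (subst homotopic_with) (auto intro!: exI[of _ G])
  moreover have "a 0 = b 0" "a 1 = b 1"
    using G(3-5)[THEN bspec, of 1] G(3)[THEN bspec, of 0] by auto
  ultimately show ?L
    using R by (simp add: path_homotopic_def)
qed

lemma path_homotopicE:
  assumes "path_homotopic X a b"
  obtains G where "continuous_map (top_of_set ({0..1::real} \<times> {0..1::real})) X G"
    "\<forall>t\<in>{0..1}. G (0, t) = a t" "\<forall>t\<in>{0..1}. G (1, t) = b t"
    "\<forall>t\<in>{0..1}. G (t, 0) = a 0" "\<forall>t\<in>{0..1}. G (t, 1) = a 1"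
proof -
  obtain G where "continuous_map (top_of_set ({0..1::real} \<times> {0..1::real})) X G"
      "\<forall>t\<in>{0..1}. G (0, t) = a t \<and> G (1, t) = b t \<and> G (t, 0) = a 0 \<and> G (t, 1) = a 1"
    using assms unfolding path_homotopic_iff by blast
  then show thesis
    by (intro that[of G]) simp_all
qed

lemma path_homotopic_compose:
  assumes "path_homotopic X a b" "continuous_map X Y f"
    and "\<And>t. t \<in> {0..1} \<Longrightarrow> a' t = f (a t)" "\<And>t. t \<in> {0..1} \<Longrightarrow> b' t = f (b t)"
  shows "path_homotopic Y a' b'"
proof -
  obtain G where G: "continuous_map (top_of_set ({0..1::real} \<times> {0..1::real})) X G"
      "\<forall>t\<in>{0..1}. G (0, t) = a t" "\<forall>t\<in>{0..1}. G (1, t) = b t"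
      "\<forall>t\<in>{0..1}. G (t, 0) = a 0" "\<forall>t\<in>{0..1}. G (t, 1) = a 1"
    using assms(1) by (rule path_homotopicE)
  have ab: "pathin X a" "pathin X b"
    using assms(1) by (simp_all add: path_homotopic_def)
  have "pathin Y a'"
    unfolding pathin_def
    by (rule continuous_map_eq[OF pathin_compose[OF ab(1) assms(2), unfolded pathin_def]])
      (simp add: assms(3))
  moreover have "pathin Y b'"
    unfolding pathin_def
    by (rule continuous_map_eq[OF pathin_compose[OF ab(2) assms(2), unfolded pathin_def]])
      (simp add: assms(4))
  moreover have "continuous_map (top_of_set ({0..1::real} \<times> {0..1::real})) Y (f \<circ> G)"
    by (rule continuous_map_compose[OF G(1) assms(2)])
  ultimately show ?thesis
    unfolding path_homotopic_iff using G(2-) assms(3,4) by (intro conjI exI[of _ "f \<circ> G"]) auto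
qed

text \<open>The loop formed by two paths a and b bounds a square H that is constant on three of its
  sides; the straight segments from these sides to the midpoint of the fourth one sweep out a
  homotopy from a to b.\<close>
lemma simply_connected_path_homotopic:
  assumes E: "simply_connected_space E" and a: "pathin E a" and b: "pathin E b"
    and ends: "a 0 = b 0" "a 1 = b 1"
  shows "path_homotopic E a b"
proof -
  define l where "l = pjoin a (prev b)"
  have "loop_at E (a 0) l"
    using a b ends by (auto simp: loop_at_def l_def pjoin_ends prev_ends intro!: pathin_pjoin pathin_prev)
  then have "path_homotopic E l (\<lambda>_. a 0)"
    using E by (simp add: simply_connected_space_def)
  then obtain H where H: "continuous_map (top_of_set ({0..1::real} \<times> {0..1::real})) E H"
      "\<forall>t\<in>{0..1}. H (0, t) = l t" "\<forall>t\<in>{0..1}. H (1, t) = a 0"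
      "\<forall>t\<in>{0..1}. H (t, 0) = l 0" "\<forall>t\<in>{0..1}. H (t, 1) = l 1"
    by (rule path_homotopicE)
  have l_ends: "l 0 = a 0" "l 1 = a 0"
    using ends by (simp_all add: l_def pjoin_ends prev_ends)
  \<comment> \<open>The point (q u, r u) runs through the corners (0,0), (1,0), (1,1), (0,1),
    turning at u = 1/3 and u = 2/3. The common target (0, 1/2) of the segments is where l switches
    from a to the reverse of b.\<close>
  define q r where "q u = min 1 (min (3 * u) (3 * (1 - u)))" and "r u = max 0 (min 1 (3 * u - 1))"
    for u :: real
  have qr: "q u \<in> {0..1}" "r u \<in> {0..1}" if "u \<in> {0..1}" for u
    using that by (auto simp: q_def r_def min_def max_def)
  define G where "G z = H ((1 - snd z) * q (fst z), (1 - snd z) * r (fst z) + snd z * (1/2))" for z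
  have "continuous_map (top_of_set ({0..1::real} \<times> {0..1::real})) E G"
    unfolding G_def
  proof (rule continuous_map_compose_on[OF H(1)])
    show "continuous_on ({0..1::real} \<times> {0..1::real})
        (\<lambda>z. ((1 - snd z) * q (fst z), (1 - snd z) * r (fst z) + snd z * (1/2)))"
      unfolding q_def r_def by (intro continuous_intros)
    have "(1 - t) * q u \<in> {0..1}" "(1 - t) * r u + t * (1/2) \<in> {0..1}"
      if "u \<in> {0..1}" "t \<in> {0..1}" for u t
    proof -
      have c: "convex {0..1::real}" by simp
      show "(1 - t) * q u \<in> {0..1}"
        using that qr[OF that(1)] by (auto intro: mult_le_one)
      show "(1 - t) * r u + t * (1/2) \<in> {0..1}"
        using convexD_alt[OF c, of "r u" "1/2" t] that qr[OF that(1)] by simp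
    qed
    then show "(\<lambda>z. ((1 - snd z) * q (fst z), (1 - snd z) * r (fst z) + snd z * (1/2)))
        \<in> {0..1::real} \<times> {0..1::real} \<rightarrow> {0..1::real} \<times> {0..1::real}"
      by auto
  qed
  moreover have "G (0, t) = a t" if "t \<in> {0..1}" for t
  proof -
    have "G (0, t) = H (0, t / 2)" by (simp add: G_def q_def r_def)
    also have "\<dots> = l (t / 2)" using H(2) that by auto
    also have "\<dots> = a t" using that by (simp add: l_def pjoin_def)
    finally show ?thesis .
  qed
  moreover have "G (1, t) = b t" if "t \<in> {0..1}" for t
  proof -
    have "G (1, t) = H (0, 1 - t / 2)"
      by (simp add: G_def q_def r_def)
    also have "\<dots> = l (1 - t / 2)" using H(2) that by auto
    also have "\<dots> = b t"
      using that ends by (auto simp: l_def pjoin_def prev_def)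
    finally show ?thesis .
  qed
  moreover have "G (u, 0) = a 0" if "u \<in> {0..1}" for u
  proof -
    consider "r u = 0" | "r u = 1" | "q u = 1"
      unfolding q_def r_def min_def max_def by (cases "u \<le> 1/3"; cases "u \<le> 2/3") auto
    then show ?thesis
      using H(2-) qr[OF that] l_ends by cases (simp_all add: G_def)
  qed
  moreover have "G (u, 1) = a 1" for u
    using H(2) by (simp add: G_def l_def pjoin_def)
  ultimately show ?thesis
    using a b unfolding path_homotopic_iff by (intro conjI exI[of _ G]) auto
qed

section \<open>Transport between fibres and sections over open sets\<close>

context covering
begin

text \<open>Monodromy, kept as a relation so that it can be stated before any lift is known to
  exist; \<open>transport_unique\<close> and \<open>transport_inj\<close> make it a partial
  injection.\<close>

definition transport :: "(real \<Rightarrow> 'a) \<Rightarrow> 'b \<Rightarrow> 'b \<Rightarrow> bool" where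
  "transport w y y' \<longleftrightarrow> (\<exists>g. pathin E g \<and> (\<forall>t\<in>{0..1}. p (g t) = w t) \<and> g 0 = y \<and> g 1 = y')"

lemma transport_mem:
  assumes "transport w y y'"
  shows "y \<in> topspace E" "y' \<in> topspace E" "p y = w 0" "p y' = w 1"
proof -
  obtain g where g: "pathin E g" "\<forall>t\<in>{0..1}. p (g t) = w t" "g 0 = y" "g 1 = y'"
    using assms unfolding transport_def by blast
  then have "g t \<in> topspace E" if "t \<in> {0..1}" for t
    using that by (auto simp: pathin_def continuous_map_def)
  with g show "y \<in> topspace E" "y' \<in> topspace E" "p y = w 0" "p y' = w 1"
    by auto
qed

lemma transport_cong:
  "transport w y y' \<Longrightarrow> (\<And>t. t \<in> {0..1} \<Longrightarrow> w t = w' t) \<Longrightarrow> transport w' y y'"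
  unfolding transport_def by metis

lemma transport_unique:
  assumes "transport w y z" "transport w y z'"
  shows "z = z'"
proof -
  obtain g h where g: "pathin E g" "\<forall>t\<in>{0..1}. p (g t) = w t" "g 0 = y" "g 1 = z"
    and h: "pathin E h" "\<forall>t\<in>{0..1}. p (h t) = w t" "h 0 = y" "h 1 = z'"
    using assms unfolding transport_def by metis
  have "g 1 = h 1"
    by (rule lifts_agree[of "top_of_set {0..1}" g h 0])
      (use g h in \<open>auto simp: pathin_def connected_space_top_of_set\<close>)
  with g h show ?thesis by simp
qed

text \<open>The lift of a square shows that both routes along its boundary and its diagonal lead
  from y to the same point. The diagonal is what turns a pointwise product of loops into a
  concatenation.\<close>

lemma transport_square:
  assumes G: "continuous_map (top_of_set ({0..1::real} \<times> {0..1::real})) B G"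
    and y: "y \<in> topspace E" "p y = G (0, 0)"
  obtains y1 y2 y3 where "transport (\<lambda>t. G (t, 0)) y y1" "transport (\<lambda>t. G (1, t)) y1 y2"
    "transport (\<lambda>t. G (0, t)) y y3" "transport (\<lambda>t. G (t, 1)) y3 y2"
    "transport (\<lambda>t. G (t, t)) y y2"
proof -
  obtain g where g: "continuous_map (top_of_set ({0..1::real} \<times> {0..1::real})) E g" "g (0, 0) = y"
      "\<forall>w\<in>{0..1::real} \<times> {0..1::real}. p (g w) = G w"
  proof -
    have "(0, 0) \<in> {0..1::real} \<times> {0..1::real}" by simp
    from liftable_square[OF G, unfolded liftable_def, rule_format, OF this y]
    show ?thesis using that by blast
  qed
  have *: "transport (\<lambda>t. G (a t, b t)) (g (a 0, b 0)) (g (a 1, b 1))"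
    if "continuous_on {0..1} a" "continuous_on {0..1} b"
      "a \<in> {0..1} \<rightarrow> {0..1}" "b \<in> {0..1} \<rightarrow> {0..1}" for a b
    unfolding transport_def
    using pathin_square[OF g(1) that] g(3) that by (intro exI[of _ "\<lambda>t. g (a t, b t)"]) auto
  show thesis
  proof (rule that)
    show "transport (\<lambda>t. G (t, 0)) y (g (1, 0))"
      using *[of "\<lambda>t. t" "\<lambda>_. 0"] g(2) by simp
    show "transport (\<lambda>t. G (1, t)) (g (1, 0)) (g (1, 1))"
      using *[of "\<lambda>_. 1" "\<lambda>t. t"] by simp
    show "transport (\<lambda>t. G (0, t)) y (g (0, 1))"
      using *[of "\<lambda>_. 0" "\<lambda>t. t"] g(2) by simp
    show "transport (\<lambda>t. G (t, 1)) (g (0, 1)) (g (1, 1))"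
      using *[of "\<lambda>t. t" "\<lambda>_. 1"] by simp
    show "transport (\<lambda>t. G (t, t)) y (g (1, 1))"
      using *[of "\<lambda>t. t" "\<lambda>t. t"] g(2) by simp
  qed
qed

lemma transport_exists:
  assumes w: "pathin B w" and y: "y \<in> topspace E" "p y = w 0"
  obtains y' where "transport w y y'"
proof -
  \<comment> \<open>A path is a square constant in the second direction, so path lifting is a case
    of square lifting.\<close>
  have "continuous_map (top_of_set ({0..1::real} \<times> {0..1::real})) B (\<lambda>z::real \<times> real. w (fst z))"
    by (rule continuous_map_compose_on[OF w[unfolded pathin_def]]) (auto intro!: continuous_intros)
  then obtain y' where "transport (\<lambda>t. w (fst (t, 0::real))) y y'"
    by (rule transport_square[OF _ y(1)]) (use y in simp_all)
  with that show thesis by simp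
qed

lemma transport_const:
  assumes "y \<in> topspace E" "p y = x"
  shows "transport (\<lambda>_. x) y y"
  unfolding transport_def using assms by (intro exI[of _ "\<lambda>_. y"]) auto

lemma transport_pjoin:
  assumes "transport g y y1" "transport h y1 y2"
  shows "transport (pjoin g h) y y2"
proof -
  obtain g' h' where g': "pathin E g'" "\<forall>t\<in>{0..1}. p (g' t) = g t" "g' 0 = y" "g' 1 = y1"
    and h': "pathin E h'" "\<forall>t\<in>{0..1}. p (h' t) = h t" "h' 0 = y1" "h' 1 = y2"
    using assms unfolding transport_def by metis
  then have "pathin E (pjoin g' h')"
    by (intro pathin_pjoin) auto
  moreover have "\<forall>t\<in>{0..1}. p (pjoin g' h' t) = pjoin g h t"
    using g'(2) h'(2) by (auto simp: pjoin_def)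
  ultimately show ?thesis
    unfolding transport_def using g' h' by (intro exI[of _ "pjoin g' h'"]) (auto simp: pjoin_ends)
qed

lemma transport_prev:
  assumes "transport g y y'"
  shows "transport (prev g) y' y"
proof -
  obtain g' where g': "pathin E g'" "\<forall>t\<in>{0..1}. p (g' t) = g t" "g' 0 = y" "g' 1 = y'"
    using assms unfolding transport_def by metis
  then show ?thesis
    unfolding transport_def
    by (intro exI[of _ "prev g'"]) (auto simp: prev_ends pathin_prev, simp add: prev_def)
qed

lemma transport_inj: "transport w y z \<Longrightarrow> transport w y' z \<Longrightarrow> y = y'"
  using transport_prev transport_unique by blast

lemma transport_back:
  assumes w: "pathin B w" and y: "y \<in> topspace E" "p y = w 1"
  obtains y' where "transport w y' y"
proof -
  obtain y' where "transport (prev w) y y'"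
    by (rule transport_exists[OF pathin_prev[OF w] y(1)]) (simp add: y prev_ends)
  from transport_prev[OF this] have "transport w y' y"
    by (simp add: prev_def[abs_def])
  with that show thesis .
qed

text \<open>The two constant sides of the homotopy lift to constant paths, so the lifts of a and b
  from y have the same end.\<close>

lemma transport_path_homotopic:
  assumes "path_homotopic B a b" "transport a y y'"
  shows "transport b y y'"
proof -
  obtain G where G: "continuous_map (top_of_set ({0..1::real} \<times> {0..1::real})) B G"
      "\<forall>t\<in>{0..1}. G (0, t) = a t" "\<forall>t\<in>{0..1}. G (1, t) = b t"
      "\<forall>t\<in>{0..1}. G (t, 0) = a 0" "\<forall>t\<in>{0..1}. G (t, 1) = a 1"
    using assms(1) by (rule path_homotopicE)
  note y = transport_mem[OF assms(2)]
  obtain y1 y2 y3 where t: "transport (\<lambda>t. G (t, 0)) y y1" "transport (\<lambda>t. G (1, t)) y1 y2"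
    "transport (\<lambda>t. G (0, t)) y y3" "transport (\<lambda>t. G (t, 1)) y3 y2"
  proof (rule transport_square[OF G(1) y(1)])
    show "p y = G (0, 0)"
      using y(3) G(2) by simp
  qed blast
  have "transport (\<lambda>_. a 0) y y1"
    by (rule transport_cong[OF t(1)]) (use G in blast)
  with transport_const y have "y1 = y"
    using transport_unique by blast
  moreover have "transport a y y3"
    by (rule transport_cong[OF t(3)]) (use G in blast)
  with assms(2) have "y3 = y'"
    using transport_unique by blast
  moreover have "transport (\<lambda>_. a 1) y3 y2"
    by (rule transport_cong[OF t(4)]) (use G in blast)
  with transport_const y \<open>y3 = y'\<close> have "y2 = y'"
    using transport_unique by blast
  moreover have "transport b y1 y2"
    by (rule transport_cong[OF t(2)]) (use G in blast)
  ultimately show ?thesis by simp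
qed

text \<open>Following a single point of the fibre suffices: lifts with common ends are homotopic in
  the simply connected E, and the homotopy is projected by p.\<close>

lemma path_homotopic_if_transport:
  assumes E: "simply_connected_space E" and "transport a y y'" "transport b y y'"
  shows "path_homotopic B a b"
proof -
  obtain g h where g: "pathin E g" "\<forall>t\<in>{0..1}. p (g t) = a t" "g 0 = y" "g 1 = y'"
    and h: "pathin E h" "\<forall>t\<in>{0..1}. p (h t) = b t" "h 0 = y" "h 1 = y'"
    using assms(2,3) unfolding transport_def by metis
  have "path_homotopic E g h"
    using g h by (intro simply_connected_path_homotopic[OF E]) auto
  then show ?thesis
    by (rule path_homotopic_compose[OF _ continuous_p]) (use g h in auto)
qed

text \<open>The section transports, inside V, a chosen point over each path component of V; local path
  connectedness makes it continuous.\<close>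
lemma section_exists:
  assumes B: "locally_path_connected_space B" and V: "openin B V"
    and closed_lifts: "\<And>x l y. loop_at (subtopology B V) x l \<Longrightarrow> y \<in> topspace E \<Longrightarrow> p y = x
      \<Longrightarrow> transport l y y"
  obtains s where "continuous_map (subtopology B V) E s" "\<And>x. x \<in> V \<Longrightarrow> p (s x) = x"
proof -
  let ?BV = "subtopology B V"
  have VB: "V \<subseteq> topspace B" using V openin_subset by blast
  \<comment> \<open>The choice depends only on the predicate \<open>path_component_of ?BV x\<close>,
    which is the same for all points of a path component.\<close>
  define rep where "rep x = (SOME z. path_component_of ?BV x z)" for x
  have rep: "path_component_of ?BV x (rep x)" if "x \<in> V" for x
  proof -
    have "path_component_of ?BV x x"
      using that VB by (auto simp: path_component_of_refl)
    then show ?thesis unfolding rep_def by (rule someI)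
  qed
  have rep_eq: "rep x = rep x'" if "path_component_of ?BV x x'" for x x'
  proof -
    have "path_component_of ?BV x = path_component_of ?BV x'"
      using that path_component_of_equiv by metis
    then show ?thesis by (simp add: rep_def)
  qed
  define \<eta> where "\<eta> z = (SOME y. y \<in> topspace E \<and> p y = z)" for z
  have \<eta>: "\<eta> z \<in> topspace E" "p (\<eta> z) = z" if "z \<in> topspace B" for z
    using someI_ex[of "\<lambda>y. y \<in> topspace E \<and> p y = z"] fibre_nonempty[OF that]
    unfolding \<eta>_def by blast+
  define lift where "lift x y \<longleftrightarrow>
      (\<exists>w. pathin ?BV w \<and> w 0 = rep x \<and> w 1 = x \<and> transport w (\<eta> (rep x)) y)" for x y
  have pathB: "pathin B w" if "pathin ?BV w" for w
    using that by (simp add: pathin_subtopology)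
  have lift_ex: "\<exists>y. lift x y" if x: "x \<in> V" for x
  proof -
    obtain w where w: "pathin ?BV w" "w 0 = rep x" "w 1 = x"
      using path_component_of_sym[OF rep[OF x]] unfolding path_component_of_def by blast
    then have "rep x \<in> topspace B"
      using path_component_in_topspace[OF rep[OF x]] by auto
    then obtain y where "transport w (\<eta> (rep x)) y"
      using transport_exists[OF pathB[OF w(1)], of "\<eta> (rep x)"] \<eta> w(2) by auto
    with w show ?thesis unfolding lift_def by blast
  qed
  \<comment> \<open>Two paths from the representative to x form a loop in V whose lift closes up by
    hypothesis, so the end of the lift does not depend on the path.\<close>
  have lift_unique: "y = y'" if lifts: "lift x y" "lift x y'" for x y y'
  proof -
    obtain w w' where w: "pathin ?BV w" "w 0 = rep x" "w 1 = x" "transport w (\<eta> (rep x)) y"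
      and w': "pathin ?BV w'" "w' 0 = rep x" "w' 1 = x" "transport w' (\<eta> (rep x)) y'"
      using lifts unfolding lift_def by blast
    have "loop_at ?BV (rep x) (pjoin w (prev w'))"
      using w w' by (auto simp: loop_at_def pjoin_ends prev_ends intro!: pathin_pjoin pathin_prev)
    then have closed: "transport (pjoin w (prev w')) (\<eta> (rep x)) (\<eta> (rep x))"
      using closed_lifts transport_mem[OF w(4)] w(2) by simp
    obtain z where z: "transport (prev w') y z"
      using transport_exists[OF pathin_prev[OF pathB[OF w'(1)]], of y] transport_mem[OF w(4)] w(3) w'(3)
      by (auto simp: prev_ends)
    from transport_unique[OF transport_pjoin[OF w(4) z] closed] z
    have "transport (prev w') y (\<eta> (rep x))" by simp
    with transport_prev[OF w'(4)] show ?thesis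
      using transport_inj by blast
  qed
  define s where "s x = (SOME y. lift x y)" for x
  have s: "lift x (s x)" if "x \<in> V" for x
    unfolding s_def using lift_ex[OF that] by (rule someI_ex)
  have s_eq: "s x = y" if "lift x y" "x \<in> V" for x y
    using s[OF that(2)] that(1) lift_unique by blast
  have local: "\<exists>N. openin B N \<and> x \<in> N \<and> N \<subseteq> V \<and> continuous_map (subtopology B N) E s" if x: "x \<in> V" for x
  proof -
    obtain U S where U: "evenly_covered U S" "x \<in> U"
      using evenly_covered_neighbourhood[of x] x VB by blast
    obtain w where w: "pathin ?BV w" "w 0 = rep x" "w 1 = x" "transport w (\<eta> (rep x)) (s x)"
      using s[OF x] unfolding lift_def by blast
    have sx: "s x \<in> topspace E" "p (s x) = x"
      using transport_mem[OF w(4)] w(3) by auto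
    then obtain W where W: "W \<in> S" "s x \<in> W"
      using U unfolding evenly_covered_def by (metis Union_iff)
    then obtain q where q: "continuous_map (subtopology B U) E q" "\<forall>x\<in>U. q x \<in> W \<and> p (q x) = x"
      and inj: "inj_on p W"
      using U unfolding evenly_covered_def by blast
    have qx: "q x = s x"
      using q(2) U(2) W(2) sx inj by (auto intro: inj_onD)
    \<comment> \<open>Points of this set are joined to x by paths that stay in both V and U. Along
      them q provides the lift, so s coincides with q here.\<close>
    define N where "N = Collect (path_component_of (subtopology B (V \<inter> U)) x)"
    have VU: "openin B (V \<inter> U)"
      using V U by (auto simp: evenly_covered_def)
    have "openin B N"
      using B VU x U(2) unfolding N_def locally_path_connected_space_eq_open_path_component_of by blast
    moreover have "x \<in> N"
      using x U(2) VB by (auto simp: N_def path_component_of_refl)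
    moreover have NVU: "N \<subseteq> V \<inter> U"
      using path_component_of_subset_topspace[of "subtopology B (V \<inter> U)" x] by (auto simp: N_def)
    moreover have "s x' = q x'" if x': "x' \<in> N" for x'
    proof -
      obtain v where v: "pathin (subtopology B (V \<inter> U)) v" "v 0 = x" "v 1 = x'"
        using x' by (auto simp: N_def path_component_of_def)
      then have vB: "pathin B v" "\<forall>t\<in>{0..1}. v t \<in> V \<inter> U"
        by (auto simp: pathin_subtopology)
      then have vBV: "pathin ?BV v" and vBU: "pathin (subtopology B U) v"
        by (auto simp: pathin_subtopology)
      have "transport v (q x) (q x')"
        unfolding transport_def
        using pathin_compose[OF vBU q(1)] q(2) vB v(2,3) by (intro exI[of _ "q \<circ> v"]) auto
      then have "transport (pjoin w v) (\<eta> (rep x)) (q x')"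
        using transport_pjoin[OF w(4)] qx by simp
      moreover have "rep x' = rep x"
        using rep_eq[of x x'] vBV v(2,3) unfolding path_component_of_def by metis
      moreover have "pathin ?BV (pjoin w v)"
        using w vBV v(2) by (intro pathin_pjoin) auto
      ultimately have "lift x' (q x')"
        unfolding lift_def using w(2) v(3)
        by (intro exI[of _ "pjoin w v"]) (simp add: pjoin_ends)
      with s_eq x' NVU show ?thesis by blast
    qed
    moreover have "continuous_map (subtopology B N) E q"
      by (rule continuous_map_from_subtopology_mono[OF q(1)]) (use NVU in blast)
    ultimately show ?thesis
      by (intro exI[of _ N]) (auto elim!: continuous_map_eq)
  qed
  then obtain N where N: "\<And>x. x \<in> V \<Longrightarrow> openin B (N x)" "\<And>x. x \<in> V \<Longrightarrow> x \<in> N x"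
      "\<And>x. x \<in> V \<Longrightarrow> N x \<subseteq> V" "\<And>x. x \<in> V \<Longrightarrow> continuous_map (subtopology B (N x)) E s"
    by metis
  show thesis
  proof (rule that)
    show "continuous_map ?BV E s"
    proof (rule pasting_lemma[of V ?BV N E "\<lambda>_. s"])
      show "openin ?BV (N x)" if "x \<in> V" for x
        using N[OF that] V by (simp add: openin_open_subtopology)
      show "continuous_map (subtopology ?BV (N x)) E s" if "x \<in> V" for x
        using N[OF that] by (simp add: subtopology_subtopology Int_absorb1)
    qed (use N in auto)
    fix x assume "x \<in> V"
    from s[OF this] obtain w where "transport w (\<eta> (rep x)) (s x)" "w 1 = x"
      unfolding lift_def by blast
    with transport_mem show "p (s x) = x" by metis
  qed
qed

end

section \<open>Division and admissible sets\<close>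

lemma continuous_map_division:
  assumes "continuous_map (prod_topology X X) X \<mu>" and "continuous_map X X \<iota>"
  shows "continuous_map (prod_topology X X) X (\<lambda>z. \<mu> (fst z, \<iota> (snd z)))"
proof -
  have "continuous_map (prod_topology X X) (prod_topology X X) (\<lambda>z. (fst z, \<iota> (snd z)))"
    using continuous_map_compose[OF continuous_map_snd[of X X] assms(2)]
    by (intro continuous_map_pairedI continuous_map_fst) (simp add: o_def)
  from continuous_map_compose[OF this assms(1)] show ?thesis
    by (simp add: o_def)
qed

context covering
begin

text \<open>The section closes the lift through s x only. Contracting this lift in E and projecting
  shows that l is null-homotopic, so the lifts through the other points of the fibre close up
  too.\<close>

lemma transport_loop_section:
  assumes E: "simply_connected_space E"
    and s: "continuous_map (subtopology B V) E s" "\<And>x. x \<in> V \<Longrightarrow> p (s x) = x"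
    and l: "loop_at (subtopology B V) x l" and y: "y \<in> topspace E" "p y = x"
  shows "transport l y y"
proof -
  have lV: "pathin (subtopology B V) l" "l 0 = x" "l 1 = x"
    using l by (auto simp: loop_at_def)
  then have lB: "pathin B l" "\<And>t. t \<in> {0..1} \<Longrightarrow> l t \<in> V"
    by (auto simp: pathin_subtopology)
  then have "x \<in> V" using lV(2) by force
  have "loop_at E (s x) (s \<circ> l)"
    using pathin_compose[OF lV(1) s(1)] lV by (simp add: loop_at_def)
  then have "path_homotopic E (s \<circ> l) (\<lambda>_. s x)"
    using E by (simp add: simply_connected_space_def)
  then have "path_homotopic B l (\<lambda>_. x)"
    by (rule path_homotopic_compose[OF _ continuous_p]) (use s(2) lB(2) \<open>x \<in> V\<close> in auto)
  moreover obtain y' where y': "transport l y y'"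
    using transport_exists[OF lB(1) y(1)] y(2) lV(2) by auto
  ultimately have "transport (\<lambda>_. x) y y'"
    by (rule transport_path_homotopic)
  with transport_const[OF y] transport_unique y' show ?thesis by blast
qed

text \<open>The homotopy drags the base point along \<tau>, so the images of a loop under F and G
  are conjugate by \<tau>; on fibres this is a commuting square of transports.\<close>

lemma transport_free_homotopy:
  assumes "homotopic_with (\<lambda>_. True) B B F G" and x: "x \<in> topspace B"
  obtains \<tau> where "pathin B \<tau>" "\<tau> 0 = F x" "\<tau> 1 = G x"
    "\<And>a y y1 z z1. loop_at B x a \<Longrightarrow> transport \<tau> y z \<Longrightarrow> transport (\<lambda>t. F (a t)) y y1
      \<Longrightarrow> transport \<tau> y1 z1 \<Longrightarrow> transport (\<lambda>t. G (a t)) z z1"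
proof -
  obtain K where K: "continuous_map (prod_topology (top_of_set {0..1::real}) B) B K"
    and K0: "\<And>x. K (0, x) = F x" and K1: "\<And>x. K (1, x) = G x"
    using assms(1) by (auto simp: homotopic_with_def)
  show thesis
  proof (rule that[of "\<lambda>t. K (t, x)"])
    have "continuous_map (top_of_set {0..1}) (prod_topology (top_of_set {0..1::real}) B) (\<lambda>t. (t, x))"
      using x by (intro continuous_map_pairedI) auto
    from continuous_map_compose[OF this K] show "pathin B (\<lambda>t. K (t, x))"
      by (simp add: pathin_def o_def)
    show "K (0, x) = F x" "K (1, x) = G x"
      by (fact K0, fact K1)
    fix a y y1 z z1
    assume a: "loop_at B x a" and t: "transport (\<lambda>t. K (t, x)) y z" "transport (\<lambda>t. F (a t)) y y1"
      "transport (\<lambda>t. K (t, x)) y1 z1"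
    have aB: "continuous_map (top_of_set {0..1}) B a" "a 0 = x" "a 1 = x"
      using a by (auto simp: loop_at_def pathin_def)
    \<comment> \<open>The loop runs in the first coordinate and the homotopy in the second, so both
      vertical sides of the square are the track of x.\<close>
    have "continuous_map (top_of_set ({0..1::real} \<times> {0..1::real}))
        (prod_topology (top_of_set {0..1::real}) B) (\<lambda>z. (snd z, a (fst z)))"
      by (intro continuous_map_pairedI continuous_map_compose_on[OF aB(1)])
        (auto simp: continuous_map_in_subtopology intro!: continuous_intros)
    from continuous_map_compose[OF this K]
    have sq: "continuous_map (top_of_set ({0..1::real} \<times> {0..1::real})) B (\<lambda>z. K (snd z, a (fst z)))"
      by (simp add: o_def)
    have y: "y \<in> topspace E" "p y = K (snd (0, 0::real), a (fst (0, 0::real)))"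
      using transport_mem[OF t(2)] by (simp_all add: K0)
    obtain y1' y2 y3 where "transport (\<lambda>t. F (a t)) y y1'" "transport (\<lambda>t. K (t, x)) y1' y2"
        "transport (\<lambda>t. K (t, x)) y y3" "transport (\<lambda>t. G (a t)) y3 y2"
      by (rule transport_square[OF sq y]) (simp add: K0 K1 aB)
    with t show "transport (\<lambda>t. G (a t)) z z1"
      using transport_unique by metis
  qed
qed

text \<open>On fundamental groups \<mu>(x, \<iota> y) induces (\<alpha>, \<beta>) \<mapsto> \<alpha> - \<beta>: the square \<mu>(a(s), \<iota> b(t))
  splits the class of \<mu>(a, \<iota> b) into that of \<mu>(a, \<iota> x0) followed by that of \<mu>(x0, \<iota> b);
  comparison with \<mu>(b, \<iota> b), which is null-homotopic, cancels the second factor.\<close>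
lemma path_homotopic_if_division_trivial:
  assumes E: "simply_connected_space E" and pc: "path_connected_space B"
    and x0: "x0 \<in> topspace B" and e: "e \<in> topspace B"
    and \<mu>: "continuous_map (prod_topology B B) B \<mu>"
    and unit: "homotopic_with (\<lambda>_. True) B B (\<lambda>x. \<mu> (x, e)) id"
    and \<iota>: "continuous_map B B \<iota>"
    and inv: "homotopic_with (\<lambda>_. True) B B (\<lambda>x. \<mu> (x, \<iota> x)) (\<lambda>_. e)"
    and a: "loop_at B x0 a" and b: "loop_at B x0 b"
    and ab: "\<And>y. y \<in> topspace E \<Longrightarrow> p y = \<mu> (x0, \<iota> x0) \<Longrightarrow> transport (\<lambda>t. \<mu> (a t, \<iota> (b t))) y y"
  shows "path_homotopic B a b"
proof -
  let ?Q = "{0..1::real} \<times> {0..1::real}"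
  have c: "\<iota> x0 \<in> topspace B"
    using \<iota> x0 by (auto simp: continuous_map_def)
  \<comment> \<open>Right translation by \<iota> x0 is moved along a path to right translation by e,
    which the right unit deforms to the identity.\<close>
  have "homotopic_with (\<lambda>_. True) B B (\<lambda>x. \<mu> (x, \<iota> x0)) (\<lambda>x. x)"
  proof (rule homotopic_with_trans)
    have "path_component_of B (\<iota> x0) e"
      using pc c e by (simp add: path_connected_space_iff_path_component)
    then have "homotopic_with (\<lambda>_. True) B B (\<lambda>_. \<iota> x0) (\<lambda>_. e)"
      by (simp add: homotopic_constant_maps)
    moreover have "homotopic_with (\<lambda>_. True) B B id id"
      by simp
    ultimately have "homotopic_with (\<lambda>_. True) (prod_topology B B) (prod_topology B B)
        (\<lambda>z. (id (fst z), \<iota> x0)) (\<lambda>z. (id (fst z), e))"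
      by (intro homotopic_with_prod_topology) auto
    from homotopic_with_compose_continuous_map_left[OF this \<mu>, of "\<lambda>_. True"]
    have 1: "homotopic_with (\<lambda>_. True) (prod_topology B B) B
        (\<lambda>z. \<mu> (fst z, \<iota> x0)) (\<lambda>z. \<mu> (fst z, e))"
      by (simp add: o_def)
    have "continuous_map B (prod_topology B B) (\<lambda>x. (x, x))"
      by (intro continuous_map_pairedI) auto
    from homotopic_with_compose_continuous_map_right[OF 1 this, of "\<lambda>_. True"]
    show "homotopic_with (\<lambda>_. True) B B (\<lambda>x. \<mu> (x, \<iota> x0)) (\<lambda>x. \<mu> (x, e))"
      by (simp add: o_def)
    show "homotopic_with (\<lambda>_. True) B B (\<lambda>x. \<mu> (x, e)) (\<lambda>x. x)"
      using unit by (simp add: id_def)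
  qed
  then obtain \<tau> where \<tau>: "pathin B \<tau>" "\<tau> 0 = \<mu> (x0, \<iota> x0)" "\<tau> 1 = x0"
    and \<tau>_t: "\<And>a y y1 z z1. loop_at B x0 a \<Longrightarrow> transport \<tau> y z \<Longrightarrow> transport (\<lambda>t. \<mu> (a t, \<iota> x0)) y y1
      \<Longrightarrow> transport \<tau> y1 z1 \<Longrightarrow> transport (\<lambda>t. a t) z z1"
    using x0 by (rule transport_free_homotopy) blast
  obtain \<sigma> where \<sigma>: "pathin B \<sigma>" "\<sigma> 0 = \<mu> (x0, \<iota> x0)" "\<sigma> 1 = e"
    and \<sigma>_t: "\<And>a y y1 z z1. loop_at B x0 a \<Longrightarrow> transport \<sigma> y z \<Longrightarrow> transport (\<lambda>t. \<mu> (a t, \<iota> (a t))) y y1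
      \<Longrightarrow> transport \<sigma> y1 z1 \<Longrightarrow> transport (\<lambda>t. e) z z1"
    using inv x0 by (rule transport_free_homotopy) blast
  obtain z where z: "z \<in> topspace E" "p z = x0"
    using fibre_nonempty[OF x0] by blast
  \<comment> \<open>The point z lies over x0, where a and b are compared; y lies over \<mu>(x0,
    \<iota> x0), the base point of the product loops.\<close>
  obtain y where y: "transport \<tau> y z"
    using transport_back[OF \<tau>(1) z(1)] z(2) \<tau>(3) by auto
  have yE: "y \<in> topspace E" "p y = \<mu> (x0, \<iota> x0)"
    using transport_mem[OF y] \<tau>(2) by auto
  have sq: "continuous_map (top_of_set ?Q) B (\<lambda>w. \<mu> (a' (fst w), \<iota> (b (snd w))))"
    if a': "loop_at B x0 a'" for a'
  proof -
    have "continuous_map (top_of_set ?Q) B (\<lambda>w. a' (fst w))"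
      by (rule continuous_map_compose_on[of "{0..1}" B a'])
        (use a' in \<open>auto simp: loop_at_def pathin_def intro!: continuous_intros\<close>)
    moreover have "continuous_map (top_of_set ?Q) B (\<lambda>w. b (snd w))"
      by (rule continuous_map_compose_on[of "{0..1}" B b])
        (use b in \<open>auto simp: loop_at_def pathin_def intro!: continuous_intros\<close>)
    from continuous_map_compose[OF this \<iota>]
    have "continuous_map (top_of_set ?Q) B (\<lambda>w. \<iota> (b (snd w)))"
      by (simp add: o_def)
    ultimately have "continuous_map (top_of_set ?Q) (prod_topology B B) (\<lambda>w. (a' (fst w), \<iota> (b (snd w))))"
      by (rule continuous_map_pairedI)
    from continuous_map_compose[OF this \<mu>] show ?thesis
      by (simp add: o_def)
  qed
  have split: "\<exists>y1. transport (\<lambda>t. \<mu> (a' t, \<iota> x0)) y y1 \<and> transport (\<lambda>t. \<mu> (x0, \<iota> (b t))) y1 y"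
    if a': "loop_at B x0 a'" and closed: "transport (\<lambda>t. \<mu> (a' t, \<iota> (b t))) y y" for a'
  proof -
    have ends: "a' 0 = x0" "a' 1 = x0" "b 0 = x0"
      using a' b by (auto simp: loop_at_def)
    obtain y1 y2 where "transport (\<lambda>t. \<mu> (a' t, \<iota> x0)) y y1" "transport (\<lambda>t. \<mu> (x0, \<iota> (b t))) y1 y2"
        "transport (\<lambda>t. \<mu> (a' t, \<iota> (b t))) y y2"
      by (rule transport_square[OF sq[OF a'] yE(1)]) (simp_all add: ends yE)
    with closed transport_unique show ?thesis by blast
  qed
  \<comment> \<open>The homotopy from \<mu>(x, \<iota> x) to e conjugates this loop by \<sigma> to a
    constant one, and injectivity of transport along \<sigma> closes its lift.\<close>
  have "transport (\<lambda>t. \<mu> (b t, \<iota> (b t))) y y"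
  proof -
    have pb: "pathin B b" "b 0 = x0" using b by (auto simp: loop_at_def)
    have "pathin B (\<lambda>t. \<mu> (b t, \<iota> (b t)))"
      using pathin_square[OF sq[OF b], of "\<lambda>t. t" "\<lambda>t. t"] by simp
    then obtain y1 where y1: "transport (\<lambda>t. \<mu> (b t, \<iota> (b t))) y y1"
      by (rule transport_exists[OF _ yE(1)]) (simp_all add: yE pb)
    then have y1E: "y1 \<in> topspace E" "p y1 = \<mu> (x0, \<iota> x0)"
      using transport_mem[OF y1] b by (auto simp: loop_at_def)
    obtain w where w: "transport \<sigma> y w"
      by (rule transport_exists[OF \<sigma>(1) yE(1)]) (simp_all add: yE \<sigma>)
    obtain w1 where w1: "transport \<sigma> y1 w1"
      by (rule transport_exists[OF \<sigma>(1) y1E(1)]) (simp_all add: y1E \<sigma>)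
    have "transport (\<lambda>_. e) w w1"
      by (rule \<sigma>_t[OF b w y1 w1])
    moreover have "transport (\<lambda>_. e) w w"
      using transport_mem[OF w] \<sigma>(3) by (intro transport_const) auto
    ultimately have "w1 = w"
      using transport_unique by blast
    with w w1 have "y1 = y"
      using transport_inj by blast
    with y1 show ?thesis by simp
  qed
  from split[OF b this] obtain yb where yb: "transport (\<lambda>t. \<mu> (b t, \<iota> x0)) y yb"
      "transport (\<lambda>t. \<mu> (x0, \<iota> (b t))) yb y"
    by blast
  from split[OF a ab[OF yE]] obtain ya where ya: "transport (\<lambda>t. \<mu> (a t, \<iota> x0)) y ya"
      "transport (\<lambda>t. \<mu> (x0, \<iota> (b t))) ya y"
    by blast
  have "ya = yb"
    using ya(2) yb(2) by (rule transport_inj)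
  have yaE: "ya \<in> topspace E" "p ya = \<mu> (x0, \<iota> x0)"
    using transport_mem[OF ya(1)] a by (auto simp: loop_at_def)
  obtain z1 where z1: "transport \<tau> ya z1"
    by (rule transport_exists[OF \<tau>(1) yaE(1)]) (simp_all add: yaE \<tau>)
  have "transport (\<lambda>t. a t) z z1"
    by (rule \<tau>_t[OF a y ya(1) z1])
  moreover have "transport (\<lambda>t. b t) z z1"
    by (rule \<tau>_t[OF b y yb(1)]) (use z1 \<open>ya = yb\<close> in simp)
  ultimately show ?thesis
    using path_homotopic_if_transport[OF E] by simp
qed

text \<open>Division sends the loops in question into V, where they act trivially on every point of
  the fibre. This survives conjugation, so any \<delta> with a constant c will do, and
  \<open>path_homotopic_if_division_trivial\<close> applies to the components of the conjugated
  loop.\<close>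

lemma D_admissible_division_preimage:
  assumes E: "simply_connected_space E" and pc: "path_connected_space B"
    and x0: "x0 \<in> topspace B" and e: "e \<in> topspace B"
    and \<mu>: "continuous_map (prod_topology B B) B \<mu>"
    and unit: "homotopic_with (\<lambda>_. True) B B (\<lambda>x. \<mu> (x, e)) id"
    and \<iota>: "continuous_map B B \<iota>"
    and inv: "homotopic_with (\<lambda>_. True) B B (\<lambda>x. \<mu> (x, \<iota> x)) (\<lambda>_. e)"
    and s: "continuous_map (subtopology B V) E s" "\<And>x. x \<in> V \<Longrightarrow> p (s x) = x"
  shows "D_admissible B x0 {z \<in> topspace (prod_topology B B). \<mu> (fst z, \<iota> (snd z)) \<in> V}"
  unfolding D_admissible_def
proof
  let ?P = "prod_topology B B"
  let ?f = "\<lambda>z. \<mu> (fst z, \<iota> (snd z))"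
  let ?U = "{z \<in> topspace ?P. ?f z \<in> V}"
  have f: "continuous_map ?P B ?f"
    using \<mu> \<iota> by (rule continuous_map_division)
  fix u assume u: "u \<in> ?U"
  have "path_connected_space ?P"
    using pc by (simp add: path_connected_space_prod_topology)
  then have "path_component_of ?P u (x0, x0)"
    using u x0 by (cases u) (simp add: path_connected_space_iff_path_component)
  then obtain \<delta> where \<delta>: "pathin ?P \<delta>" "\<delta> 0 = u" "\<delta> 1 = (x0, x0)"
    unfolding path_component_of_def by blast
  define c where "c = (\<lambda>_::real. (x0, x0))"
  have c: "loop_at ?P (x0, x0) c"
    using x0 by (simp add: c_def loop_at_def)
  have "\<exists>m. loop_at B x0 m \<and> path_homotopic ?P (pjoin (prev c) (pjoin (prev \<delta>) (pjoin l (pjoin \<delta> c))))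
      (\<lambda>t. (m t, m t))" if l: "loop_at (subtopology ?P ?U) u l" for l
  proof -
    define w where "w = pjoin (prev c) (pjoin (prev \<delta>) (pjoin l (pjoin \<delta> c)))"
    have lP: "pathin ?P l" "l 0 = u" "l 1 = u"
      using l by (auto simp: loop_at_def pathin_subtopology)
    have w: "loop_at ?P (x0, x0) w"
      using c \<delta> lP unfolding w_def loop_at_def
      by (auto simp: pjoin_ends prev_ends intro!: pathin_pjoin pathin_prev)
    have w12: "loop_at B x0 (\<lambda>t. fst (w t))" "loop_at B x0 (\<lambda>t. snd (w t))"
      using w by (auto simp: loop_at_def pathin_def continuous_map_pairwise o_def)
    have fl: "loop_at (subtopology B V) (?f u) (\<lambda>t. ?f (l t))"
    proof -
      have "continuous_map (subtopology ?P ?U) (subtopology B V) ?f"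
        using f by (auto simp: continuous_map_in_subtopology continuous_map_from_subtopology)
      with l show ?thesis
        using pathin_compose[of "subtopology ?P ?U" l "subtopology B V" ?f] by (auto simp: loop_at_def o_def)
    qed
    have "transport (\<lambda>t. ?f (w t)) y y" if y: "y \<in> topspace E" "p y = \<mu> (x0, \<iota> x0)" for y
    proof -
      have "pathin B (\<lambda>t. ?f (\<delta> t))"
        using pathin_compose[OF \<delta>(1) f] by (simp add: o_def)
      then obtain y1 where y1: "transport (\<lambda>t. ?f (\<delta> t)) y1 y"
        by (rule transport_back[OF _ y(1)]) (simp_all add: y \<delta>)
      have tc: "transport (\<lambda>t. ?f (c t)) y y"
        using transport_const[OF y] by (simp add: c_def)
      have "transport (\<lambda>t. ?f (l t)) y1 y1"
        by (rule transport_loop_section[OF E s fl]) (use transport_mem[OF y1] \<delta>(2) in auto)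
      then have "transport (pjoin (prev (\<lambda>t. ?f (c t))) (pjoin (prev (\<lambda>t. ?f (\<delta> t)))
          (pjoin (\<lambda>t. ?f (l t)) (pjoin (\<lambda>t. ?f (\<delta> t)) (\<lambda>t. ?f (c t)))))) y y"
        by (intro transport_pjoin[OF transport_prev[OF tc]] transport_pjoin[OF transport_prev[OF y1]]
            transport_pjoin[OF _ transport_pjoin[OF y1 tc]])
      then show ?thesis
        by (rule transport_cong) (simp add: w_def pjoin_def prev_def)
    qed
    then have "path_homotopic B (\<lambda>t. fst (w t)) (\<lambda>t. snd (w t))"
      by (intro path_homotopic_if_division_trivial[OF E pc x0 e \<mu> unit \<iota> inv w12]) simp
    then obtain G where G: "continuous_map (top_of_set ({0..1::real} \<times> {0..1::real})) B G"
      "\<forall>t\<in>{0..1}. G (0, t) = fst (w t)" "\<forall>t\<in>{0..1}. G (1, t) = snd (w t)"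
      "\<forall>t\<in>{0..1}. G (t, 0) = fst (w 0)" "\<forall>t\<in>{0..1}. G (t, 1) = fst (w 1)"
      by (rule path_homotopicE)
    have w2: "continuous_map (top_of_set {0..1}) B (\<lambda>t. snd (w t))"
      using w12(2) by (simp add: loop_at_def pathin_def)
    \<comment> \<open>The first component is deformed into the second, which stays fixed; thus w
      ends in the diagonal.\<close>
    have "continuous_map (top_of_set ({0..1::real} \<times> {0..1::real})) ?P (\<lambda>z. (G z, snd (w (snd z))))"
      by (intro continuous_map_pairedI G(1) continuous_map_compose_on[OF w2])
        (auto intro!: continuous_intros)
    moreover have "pathin ?P w" "pathin ?P (\<lambda>t. (snd (w t), snd (w t)))" "w 0 = (x0, x0)" "w 1 = (x0, x0)"
      using w w2 by (auto simp: loop_at_def pathin_def intro!: continuous_map_pairedI)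
    ultimately have "path_homotopic ?P w (\<lambda>t. (snd (w t), snd (w t)))"
      unfolding path_homotopic_iff using G(2-)
      by (intro conjI exI[of _ "\<lambda>z. (G z, snd (w (snd z)))"]) auto
    with w12(2) show ?thesis
      unfolding w_def by blast
  qed
  with \<delta> c show "\<exists>\<delta> c. pathin ?P \<delta> \<and> \<delta> 0 = u \<and> \<delta> 1 = (x0, x0) \<and> loop_at ?P (x0, x0) c \<and>
      (\<forall>l. loop_at (subtopology ?P ?U) u l \<longrightarrow> (\<exists>m. loop_at B x0 m \<and>
        path_homotopic ?P (pjoin (prev c) (pjoin (prev \<delta>) (pjoin l (pjoin \<delta> c)))) (\<lambda>t. (m t, m t))))"
    by blast
qed

text \<open>The first component of the loop is constant, so m is homotopic to a conjugate of a
  constant path; the second component then shows that a conjugate of l, and hence l, acts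
  trivially.\<close>

lemma transport_loop_D_admissible_slice:
  assumes x0: "x0 \<in> topspace B" and U: "D_admissible B x0 U"
    and l: "loop_at (subtopology B {x \<in> topspace B. (x0, x) \<in> U}) x l"
    and y: "y \<in> topspace E" "p y = x"
  shows "transport l y y"
proof -
  let ?P = "prod_topology B B"
  have lB: "pathin B l" "l 0 = x" "l 1 = x" "\<forall>t\<in>{0..1}. (x0, l t) \<in> U"
    using l by (auto simp: loop_at_def pathin_subtopology)
  then have "(x0, x) \<in> U" by force
  then obtain \<delta> c where \<delta>: "pathin ?P \<delta>" "\<delta> 0 = (x0, x)" "\<delta> 1 = (x0, x0)"
    and c: "loop_at ?P (x0, x0) c"
    and adm: "\<And>l. loop_at (subtopology ?P U) (x0, x) l \<Longrightarrow> \<exists>m. loop_at B x0 m \<and>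
        path_homotopic ?P (pjoin (prev c) (pjoin (prev \<delta>) (pjoin l (pjoin \<delta> c)))) (\<lambda>t. (m t, m t))"
    using U unfolding D_admissible_def by blast
  have "pathin ?P (\<lambda>t. (x0, l t))"
    using lB(1) x0 by (auto simp: pathin_def intro!: continuous_map_pairedI)
  then have "loop_at (subtopology ?P U) (x0, x) (\<lambda>t. (x0, l t))"
    using lB by (simp add: loop_at_def pathin_subtopology)
  then obtain m where m: "path_homotopic ?P
      (pjoin (prev c) (pjoin (prev \<delta>) (pjoin (\<lambda>t. (x0, l t)) (pjoin \<delta> c)))) (\<lambda>t. (m t, m t))"
    using adm by blast
  define \<delta>1 \<delta>2 c1 c2 where "\<delta>1 = (\<lambda>t. fst (\<delta> t))" and "\<delta>2 = (\<lambda>t. snd (\<delta> t))"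
    and "c1 = (\<lambda>t. fst (c t))" and "c2 = (\<lambda>t. snd (c t))"
  note defs = \<delta>1_def \<delta>2_def c1_def c2_def
  have paths: "pathin B \<delta>1" "pathin B \<delta>2" "pathin B c1" "pathin B c2"
    using \<delta>(1) c by (auto simp: defs loop_at_def pathin_def continuous_map_pairwise o_def)
  have ends: "\<delta>1 0 = x0" "\<delta>1 1 = x0" "\<delta>2 0 = x" "\<delta>2 1 = x0" "c1 0 = x0" "c1 1 = x0" "c2 0 = x0" "c2 1 = x0"
    using \<delta> c by (auto simp: defs loop_at_def)
  have h1: "path_homotopic B (pjoin (prev c1) (pjoin (prev \<delta>1) (pjoin (\<lambda>_. x0) (pjoin \<delta>1 c1)))) m"
    by (rule path_homotopic_compose[OF m continuous_map_fst]) (auto simp: defs pjoin_def prev_def)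
  have h2: "path_homotopic B (pjoin (prev c2) (pjoin (prev \<delta>2) (pjoin l (pjoin \<delta>2 c2)))) m"
    by (rule path_homotopic_compose[OF m continuous_map_snd]) (auto simp: defs pjoin_def prev_def)
  \<comment> \<open>The point y is carried along \<delta>2 and c2 to y2 over x0, where both
    conjugated loops are based; v1 and v2 trace y2 back along c1 and \<delta>1.\<close>
  obtain y1 where y1: "transport \<delta>2 y y1"
    by (rule transport_exists[OF paths(2) y(1)]) (simp_all add: y ends)
  note m1 = transport_mem[OF y1]
  obtain y2 where y2: "transport c2 y1 y2"
    by (rule transport_exists[OF paths(4) m1(2)]) (simp_all add: m1 ends)
  note m2 = transport_mem[OF y2]
  obtain v1 where v1: "transport c1 v1 y2"
    by (rule transport_back[OF paths(3) m2(2)]) (simp_all add: m2 ends)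
  note n1 = transport_mem[OF v1]
  obtain v2 where v2: "transport \<delta>1 v2 v1"
    by (rule transport_back[OF paths(1) n1(1)]) (simp_all add: n1 ends)
  have "transport (\<lambda>_. x0) v2 v2"
    using transport_mem[OF v2] ends by (intro transport_const) auto
  then have "transport (pjoin (prev c1) (pjoin (prev \<delta>1) (pjoin (\<lambda>_. x0) (pjoin \<delta>1 c1)))) y2 y2"
    by (intro transport_pjoin[OF transport_prev[OF v1]] transport_pjoin[OF transport_prev[OF v2]]
        transport_pjoin[OF _ transport_pjoin[OF v2 v1]])
  then have m_closed: "transport m y2 y2"
    by (rule transport_path_homotopic[OF h1])
  \<comment> \<open>The end y' of the lift of l is carried along the same two paths. Since m fixes
    y2, it also arrives at y2, and injectivity of the transports yields y' = y.\<close>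
  obtain y' where y': "transport l y y'"
    by (rule transport_exists[OF lB(1) y(1)]) (simp_all add: y lB)
  note m' = transport_mem[OF y']
  obtain y1' where y1': "transport \<delta>2 y' y1'"
    by (rule transport_exists[OF paths(2) m'(2)]) (simp_all add: m' lB ends)
  note m1' = transport_mem[OF y1']
  obtain y2' where y2': "transport c2 y1' y2'"
    by (rule transport_exists[OF paths(4) m1'(2)]) (simp_all add: m1' ends)
  have "transport (pjoin (prev c2) (pjoin (prev \<delta>2) (pjoin l (pjoin \<delta>2 c2)))) y2 y2'"
    by (intro transport_pjoin[OF transport_prev[OF y2]] transport_pjoin[OF transport_prev[OF y1]]
        transport_pjoin[OF y' transport_pjoin[OF y1' y2']])
  then have "transport m y2 y2'"
    by (rule transport_path_homotopic[OF h2])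
  with m_closed have "y2' = y2"
    using transport_unique by blast
  with y2 y2' have "y1' = y1"
    using transport_inj by blast
  with y1 y1' have "y' = y"
    using transport_inj by blast
  with y' show ?thesis by simp
qed

end

section \<open>Matching open covers of the square of X with open covers of X\<close>

theorem mainTheorem11:
  fixes X :: "'a topology" and x0 :: 'a and E :: "'b topology" and p :: "'b \<Rightarrow> 'a"
  assumes "cw_complex X" and "connected_space X" and "h_space X"
    and "x0 \<in> topspace X"
    and "universal_covering E X p"
  shows "TC_D X x0 = secat p E X"
proof -
  obtain C where "cw_structure X C"
    using cw_complex_structure[OF assms(1)] .
  then interpret cw_structure X C .
  interpret covering E X p
    using assms(5) by unfold_locales (simp add: universal_covering_def)
  have E: "simply_connected_space E"
    using assms(5) by (simp add: universal_covering_def)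
  have pc: "path_connected_space X"
    using path_connected_eq_connected_space[OF locally_path_connected] assms(2) by simp
  obtain \<mu> e where e: "e \<in> topspace X" and \<mu>: "continuous_map (prod_topology X X) X \<mu>"
    and unit: "homotopic_with (\<lambda>_. True) X X (\<lambda>x. \<mu> (e, x)) id"
      "homotopic_with (\<lambda>_. True) X X (\<lambda>x. \<mu> (x, e)) id"
    using assms(3) unfolding h_space_def by blast
  obtain \<iota> where \<iota>: "continuous_map X X \<iota>"
    and inv: "homotopic_with (\<lambda>_. True) X X (\<lambda>x. \<mu> (x, \<iota> x)) (\<lambda>_. e)"
    using homotopy_inverse[OF pc e \<mu> unit(1)] .
  let ?P = "prod_topology X X"
  let ?f = "\<lambda>z. \<mu> (fst z, \<iota> (snd z))"
  have f: "continuous_map ?P X ?f"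
    using \<mu> \<iota> by (rule continuous_map_division)
  \<comment> \<open>The equivalence holds for each n separately, so both infima range over the same
    set, also when it is empty and the value is infinite.\<close>
  have "(\<exists>U :: nat \<Rightarrow> ('a \<times> 'a) set. (\<forall>i\<le>n. openin ?P (U i) \<and> D_admissible X x0 (U i)) \<and>
      (\<Union>i\<le>n. U i) = topspace ?P) \<longleftrightarrow>
    (\<exists>U :: nat \<Rightarrow> 'a set. (\<forall>i\<le>n. openin X (U i) \<and>
         (\<exists>s. continuous_map (subtopology X (U i)) E s \<and> (\<forall>x\<in>U i. p (s x) = x))) \<and>
      (\<Union>i\<le>n. U i) = topspace X)" (is "?TC n \<longleftrightarrow> ?cat n") for n
  proof
    assume "?TC n"
    then obtain U where U: "\<And>i. i \<le> n \<Longrightarrow> openin ?P (U i)" "\<And>i. i \<le> n \<Longrightarrow> D_admissible X x0 (U i)"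
      and cover: "(\<Union>i\<le>n. U i) = topspace ?P"
      by blast
    define V where "V i = {x \<in> topspace X. (x0, x) \<in> U i}" for i
    have V: "openin X (V i)" if "i \<le> n" for i
    proof -
      have "continuous_map X ?P (\<lambda>x. (x0, x))"
        using assms(4) by (intro continuous_map_pairedI) auto
      from openin_continuous_map_preimage[OF this U(1)[OF that]] show ?thesis
        by (simp add: V_def)
    qed
    have "\<exists>s. continuous_map (subtopology X (V i)) E s \<and> (\<forall>x\<in>V i. p (s x) = x)" if i: "i \<le> n" for i
    proof (rule section_exists[OF locally_path_connected V[OF i]])
      show "transport l y y" if "loop_at (subtopology X (V i)) x l" "y \<in> topspace E" "p y = x" for x l y
        using transport_loop_D_admissible_slice[OF assms(4) U(2)[OF i]] that unfolding V_def by blast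
    qed blast
    moreover have "(\<Union>i\<le>n. V i) = topspace X"
    proof
      show "topspace X \<subseteq> (\<Union>i\<le>n. V i)"
      proof
        fix x assume x: "x \<in> topspace X"
        then have "(x0, x) \<in> (\<Union>i\<le>n. U i)"
          unfolding cover using assms(4) by simp
        with x show "x \<in> (\<Union>i\<le>n. V i)"
          by (auto simp: V_def)
      qed
    qed (auto simp: V_def)
    ultimately show "?cat n"
      using V by blast
  next
    assume "?cat n"
    then obtain V where V: "\<And>i. i \<le> n \<Longrightarrow> openin X (V i)"
        "\<And>i. i \<le> n \<Longrightarrow> \<exists>s. continuous_map (subtopology X (V i)) E s \<and> (\<forall>x\<in>V i. p (s x) = x)"
      and cover: "(\<Union>i\<le>n. V i) = topspace X"
      by blast
    define U where "U i = {z \<in> topspace ?P. ?f z \<in> V i}" for i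
    have "openin ?P (U i)" if "i \<le> n" for i
      unfolding U_def by (rule openin_continuous_map_preimage[OF f V(1)[OF that]])
    moreover have "D_admissible X x0 (U i)" if i: "i \<le> n" for i
    proof -
      obtain s where "continuous_map (subtopology X (V i)) E s" "\<forall>x\<in>V i. p (s x) = x"
        using V(2)[OF i] by blast
      then show ?thesis
        unfolding U_def
        by (intro D_admissible_division_preimage[OF E pc assms(4) e \<mu> unit(2) \<iota> inv, of "V i" s]) auto
    qed
    moreover have "(\<Union>i\<le>n. U i) = topspace ?P"
    proof
      show "topspace ?P \<subseteq> (\<Union>i\<le>n. U i)"
      proof
        fix z assume z: "z \<in> topspace ?P"
        then have "?f z \<in> (\<Union>i\<le>n. V i)"
          unfolding cover using f by (auto simp: continuous_map_def)
        with z show "z \<in> (\<Union>i\<le>n. U i)"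
          by (auto simp: U_def)
      qed
    qed (auto simp: U_def)
    ultimately show "?TC n"
      by blast
  qed
  then show ?thesis
    unfolding TC_D_def secat_def by simp
qed

end
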